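(* Let $k\ge1$ be an integer and let the coupling constants on the edges of the strip lattice $\mathcal C_k$ be independent and identically distributed mean-zero (nondegenerate) Gaussians. Then, with probability strictly bigger than zero, there is a nested sequence $S_1\subseteq S_2\subseteq\cdots$ of finite sublattices converging to $\mathcal C_k$ such that, if $e_j$ is a c-groundstate in $S_{2j}$ and $o_j$ is a c-groundstate in $S_{2j-1}$ for every $j\ge1$, then both sequences $(e_j)$ and $(o_j)$ converge, and their limits $e,o$ are finitely incongruent states of $\mathcal C_k$.
   Context: The strip lattice $\mathcal C_k$ is the subgraph of the square lattice induced on the vertices $(i,j)\in\mathbb Z^2$ with $|i|\le k$ and $j$ arbitrary. Each edge $\{i,j\}$ carries a coupling constant $J_{ij}$. A state (spin assignment) on a graph $(V,E)$ is a map $\sigma:V\to\{\pm1\}$; its energy, for a finite graph, is $E(\sigma)=-\sum_{\{i,j\}\in E}J_{ij}\sigma_i\sigma_j$. An edge $ij$ is satisfied by $\sigma$ if $J_{ij}\sigma_i\sigma_j>0$. Finite sublattices are rectangular subgraphs, e.g. $C(n,k)$, the subgraph induced on the vertices $(i,j)$ with $|i|\le k$, $|j|\le n$. A nested sequence of them converges to $\mathcal C_k$ if its union is $\mathcal C_k$. The boundary of a finite sublattice is its outer boundary cycle. A c-groundstate of a finite sublattice is a state of minimum energy subject to the boundary condition that the spins along the boundary are fixed so that the maximum possible number of boundary edges is satisfied (all of them if the number of boundary edges with negative coupling constant is even, all but one otherwise). States are considered up to global reversal of all spins; a sequence of states on finite sublattices converges if for every edge $ij$ of $\mathcal C_k$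 the product $\sigma_i\sigma_j$ is eventually constant. Plaquettes are the unit squares of the lattice. The dual graph has the plaquettes of $\mathcal C_k$ as vertices and an edge $e^*$ for each edge $e$ of $\mathcal C_k$ not on its boundary, joining the two plaquettes containing $e$. The domain walls between two states are the connected components, in the dual graph, of the set of (duals of) edges satisfied by exactly one of the two states. Two states are finitely incongruent if at least one domain wall between them contains a path that is infinite and unbounded in both ways. *)

theory Defs
  imports "HOL-Probability.Probability"
begin

type_synonym vertex = "int \<times> int"
type_synonym edge = "vertex set"
type_synonym state = "vertex \<Rightarrow> real"

definition adjacent :: "vertex \<Rightarrow> vertex \<Rightarrow> bool" where
  "adjacent u v \<longleftrightarrow> \<bar>fst u - fst v\<bar> + \<bar>snd u - snd v\<bar> = 1"

text \<open>Subgraphs of the square lattice are induced, hence given by their vertex sets.\<close>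

definition edges :: "vertex set \<Rightarrow> edge set" where
  "edges V = {{u, v} | u v. u \<in> V \<and> v \<in> V \<and> adjacent u v}"

definition strip :: "int \<Rightarrow> vertex set" where
  "strip k = {v. \<bar>fst v\<bar> \<le> k}"

text \<open>The strict inequalities ensure that the outer boundary is a cycle.\<close>

definition finite_sublattice :: "int \<Rightarrow> vertex set \<Rightarrow> bool" where
  "finite_sublattice k S \<longleftrightarrow>
     (\<exists>a b c d. a < b \<and> c < d \<and> S = {a..b} \<times> {c..d} \<and> S \<subseteq> strip k)"

text \<open>A plaquette is represented by its corner with the smallest coordinates.\<close>

type_synonym plaquette = "int \<times> int"

definition corners :: "plaquette \<Rightarrow> vertex set" where
  "corners p = {fst p, fst p + 1} \<times> {snd p, snd p + 1}"

definition plaquettes :: "vertex set \<Rightarrow> plaquette set" where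
  "plaquettes V = {p. corners p \<subseteq> V}"

definition plaquettes_containing :: "vertex set \<Rightarrow> edge \<Rightarrow> plaquette set" where
  "plaquettes_containing V e = {p \<in> plaquettes V. e \<subseteq> corners p}"

text \<open>Every bounded face of a rectangle or of a strip is a plaquette, so the edges bordering
  the outside are those on exactly one plaquette. For a rectangle they form the outer boundary
  cycle; for a strip they are the edges on its two sides.\<close>

definition boundary_edges :: "vertex set \<Rightarrow> edge set" where
  "boundary_edges V = {e \<in> edges V. card (plaquettes_containing V e) = 1}"

text \<open>Values outside \<open>V\<close> are irrelevant.\<close>

definition is_state :: "vertex set \<Rightarrow> state \<Rightarrow> bool" where
  "is_state V \<sigma> \<longleftrightarrow> (\<forall>v\<in>V. \<sigma> v \<in> {-1, 1})"

definition spin_product :: "state \<Rightarrow> edge \<Rightarrow> real" where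
  "spin_product \<sigma> e = (\<Prod>v\<in>e. \<sigma> v)"

definition energy :: "(edge \<Rightarrow> real) \<Rightarrow> vertex set \<Rightarrow> state \<Rightarrow> real" where
  "energy J V \<sigma> = - (\<Sum>e\<in>edges V. J e * spin_product \<sigma> e)"

definition satisfied :: "(edge \<Rightarrow> real) \<Rightarrow> state \<Rightarrow> edge \<Rightarrow> bool" where
  "satisfied J \<sigma> e \<longleftrightarrow> J e * spin_product \<sigma> e > 0"

definition c_boundary_condition :: "(edge \<Rightarrow> real) \<Rightarrow> vertex set \<Rightarrow> state \<Rightarrow> bool" where
  "c_boundary_condition J S \<sigma> \<longleftrightarrow>
     is_arg_max (\<lambda>\<tau>. card {e \<in> boundary_edges S. satisfied J \<tau> e}) (is_state S) \<sigma>"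

definition c_groundstate :: "(edge \<Rightarrow> real) \<Rightarrow> vertex set \<Rightarrow> state \<Rightarrow> bool" where
  "c_groundstate J S \<sigma> \<longleftrightarrow> is_arg_min (energy J S) (c_boundary_condition J S) \<sigma>"

text \<open>Spin products determine a state of the (connected) strip up to global reversal, so this
  is convergence of states modulo reversal; the limit is any representative.\<close>

definition converges_to :: "int \<Rightarrow> (nat \<Rightarrow> state) \<Rightarrow> state \<Rightarrow> bool" where
  "converges_to k s \<sigma> \<longleftrightarrow> is_state (strip k) \<sigma> \<and>
     (\<forall>e\<in>edges (strip k). eventually (\<lambda>j. spin_product (s j) e = spin_product \<sigma> e) sequentially)"

text \<open>The dual of a non-boundary edge is the set of the two plaquettes containing it.\<close>

definition differing_dual_edges ::
    "(edge \<Rightarrow> real) \<Rightarrow> int \<Rightarrow> state \<Rightarrow> state \<Rightarrow> plaquette set set" where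
  "differing_dual_edges J k \<sigma> \<tau> = plaquettes_containing (strip k) `
     {e \<in> edges (strip k) - boundary_edges (strip k). satisfied J \<sigma> e \<noteq> satisfied J \<tau> e}"

text \<open>Connected components, as edge sets, of the graph with a given set of edges.\<close>

definition edge_components :: "'a set set \<Rightarrow> 'a set set set" where
  "edge_components D = D // {(x, y). x \<in> D \<and> y \<in> D \<and> x \<inter> y \<noteq> {}}\<^sup>*"

definition domain_walls ::
    "(edge \<Rightarrow> real) \<Rightarrow> int \<Rightarrow> state \<Rightarrow> state \<Rightarrow> plaquette set set set" where
  "domain_walls J k \<sigma> \<tau> = edge_components (differing_dual_edges J k \<sigma> \<tau>)"

text \<open>The path is simple and two-way infinite, and unbounded in both directions of the strip.
  As the strip has finitely many plaquettes in each row, one half of the path is then unbounded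
  above and the other one unbounded below.\<close>

definition finitely_incongruent ::
    "(edge \<Rightarrow> real) \<Rightarrow> int \<Rightarrow> state \<Rightarrow> state \<Rightarrow> bool" where
  "finitely_incongruent J k \<sigma> \<tau> \<longleftrightarrow>
     (\<exists>W \<in> domain_walls J k \<sigma> \<tau>. \<exists>p :: int \<Rightarrow> plaquette.
        inj p \<and> (\<forall>n. {p n, p (n + 1)} \<in> W) \<and>
        (\<forall>b. \<exists>n. snd (p n) > b) \<and> (\<forall>b. \<exists>n. snd (p n) < b))"

text \<open>Sequences are indexed from 1. The union of the induced edge sets is then also that of
  the strip, by nestedness.\<close>

definition exhausting_sublattices :: "int \<Rightarrow> (nat \<Rightarrow> vertex set) \<Rightarrow> bool" where
  "exhausting_sublattices k S \<longleftrightarrow>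
     (\<forall>n\<ge>1. finite_sublattice k (S n) \<and> S n \<subseteq> S (n + 1)) \<and> (\<Union>n\<in>{1..}. S n) = strip k"

end

theory Submission
  imports Defs
begin

text \<open>
The theorem rests on a parity. A rectangle spanning the strip has no frustration on its boundary
if its bottom and its top row have the same \<open>row_sign\<close>; its c-groundstates then satisfy every
boundary edge (\<open>boundary_satisfied\<close>), and the sign \<open>\<epsilon>\<close> of the bottom row fixes the orientation of
the right side relative to the left side (\<open>ends_product\<close>). Consider one exhausting family of
rectangles with \<open>\<epsilon> = 1\<close> and one with \<open>\<epsilon> = - 1\<close>, and suppose that the groundstates of both
converge. Both limits satisfy all edges of the two sides of the strip, but they relate the sides by
opposite signs. So their product is constant on each side, with opposite values, and changes sign an
odd number of times along every row.

The places where it changes form a graph of even degrees on the plaquettes, crossed an odd number of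
times by row zero. Some component of it is crossed an odd number of times as well, and such a
component cannot be finite above or below row zero, by counting degrees
(\<open>infinite_side_of_odd_cut\<close>). Koenig's lemma gives a ray upwards and a ray downwards in this domain
wall, and a shortest connection joins them to a simple path unbounded in both directions
(\<open>two_way_path_of_odd_cut\<close>, \<open>finitely_incongruentI\<close>).

Both families exist and can be made to converge, with probability one. Gaussian couplings almost
surely exclude ties between energies of finite systems, so groundstates are unique up to reversal
(\<open>c_groundstate_unique\<close>) and a diagonal sequence of rectangles makes them converge
(\<open>convergent_subsequence\<close>). Consecutive rows have opposite signs if precisely one coupling on the
cycle that they bound together is negative and no other coupling on it vanishes. These events
have a probability bounded below and are independent for disjoint cycles, so almost surely both row
signs occur arbitrarily far up and down (\<open>AE_flips\<close>). The deterministic part of the argument is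
assembled in \<open>incongruent_limits\<close>.
\<close>

section \<open>Two-way infinite paths in graphs with even degrees\<close>

lemma even_sum_degrees:
  fixes r :: "'v \<Rightarrow> 'v \<Rightarrow> bool"
  assumes "finite U" and sym: "symp r" and irrefl: "irreflp r"
  shows "even (\<Sum>v\<in>U. card {u \<in> U. r v u})"
  using assms(1)
proof (induction U rule: finite_induct)
  case empty
  then show ?case by simp
next
  case (insert x F)
  have step: "card {u \<in> insert x F. r v u} = card {u \<in> F. r v u} + of_bool (r v x)" for v
  proof (cases "r v x")
    case True
    then have "{u \<in> insert x F. r v u} = insert x {u \<in> F. r v u}" by auto
    then show ?thesis using insert.hyps True by simp
  next
    case False
    then have "{u \<in> insert x F. r v u} = {u \<in> F. r v u}" by auto
    then show ?thesis using False by simp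
  qed
  have "(\<Sum>v\<in>F. of_bool (r v x)) = card {u \<in> F. r x u}"
    using insert.hyps(1) sympD[OF sym]
    by (auto simp: sum_of_bool_eq intro!: arg_cong[of _ _ card])
  then have "(\<Sum>v\<in>insert x F. card {u \<in> insert x F. r v u})
      = 2 * card {u \<in> F. r x u} + (\<Sum>v\<in>F. card {u \<in> F. r v u})"
    using insert.hyps irreflpD[OF irrefl] by (simp only: step sum.distrib sum.insert) simp
  then show ?case using insert.IH by simp
qed

text \<open>Otherwise the set \<open>U\<close> of everything reachable inside \<open>A\<close> from the cut is finite. Its
  degrees sum to an even number; the edges inside \<open>U\<close> are counted twice, so the number of edges
  leaving \<open>U\<close> is even. But these are precisely the edges of the odd cut.\<close>

lemma infinite_side_of_odd_cut:
  fixes r :: "'v \<Rightarrow> 'v \<Rightarrow> bool"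
  assumes sym: "symp r" and irrefl: "irreflp r"
    and fin: "\<And>v. finite {u. r v u}" and ev: "\<And>v. even (card {u. r v u})"
    and odd: "odd (card {(v, u). v \<in> A \<and> u \<notin> A \<and> r v u})"
  obtains v where "v \<in> A" "infinite {w. (\<lambda>a b. r a b \<and> b \<in> A)\<^sup>*\<^sup>* v w}"
proof -
  let ?K = "{(v, u). v \<in> A \<and> u \<notin> A \<and> r v u}"
  let ?q = "\<lambda>a b. r a b \<and> b \<in> A"
  define S where "S = fst ` ?K"
  define U where "U = (\<Union>v\<in>S. {w. ?q\<^sup>*\<^sup>* v w})"
  have finS: "finite S" using odd card.infinite unfolding S_def by fastforce
  have SA: "S \<subseteq> A" by (auto simp: S_def)
  have KS: "v \<in> S" if "v \<in> A" "u \<notin> A" "r v u" for u v using that unfolding S_def by force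
  have UA: "U \<subseteq> A"
  proof
    fix w assume "w \<in> U"
    then obtain v where "v \<in> S" "?q\<^sup>*\<^sup>* v w" by (auto simp: U_def)
    from this(2,1) show "w \<in> A" using SA by (induction) auto
  qed
  have SU: "S \<subseteq> U" by (auto simp: U_def)
  have "infinite U"
  proof
    assume finU: "finite U"
    have closed: "u \<in> U" if vu: "v \<in> U" "r v u" "u \<in> A" for u v
    proof -
      obtain v0 where v0: "v0 \<in> S" "?q\<^sup>*\<^sup>* v0 v" using vu(1) by (auto simp: U_def)
      have "?q\<^sup>*\<^sup>* v0 u" by (rule rtranclp.rtrancl_into_rtrancl[OF v0(2)]) (use vu in simp)
      then show ?thesis using v0(1) by (auto simp: U_def)
    qed
    have K: "?K = Sigma U (\<lambda>v. {u. r v u \<and> u \<notin> U})"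
      using KS SU UA closed by blast
    have split: "card {u. r v u} = card {u \<in> U. r v u} + card {u. r v u \<and> u \<notin> U}" for v
    proof -
      have "{u. r v u} = {u \<in> U. r v u} \<union> {u. r v u \<and> u \<notin> U}" by blast
      moreover have "finite {u \<in> U. r v u}" "finite {u. r v u \<and> u \<notin> U}"
        using fin[of v] by (auto elim: rev_finite_subset)
      ultimately show ?thesis
        by (metis (no_types, lifting) card_Un_disjoint disjoint_iff mem_Collect_eq)
    qed
    have cut: "card ?K = (\<Sum>v\<in>U. card {u. r v u \<and> u \<notin> U})"
      unfolding K using finU fin by (subst card_SigmaI) (auto elim: rev_finite_subset)
    have total: "(\<Sum>v\<in>U. card {u. r v u})
        = (\<Sum>v\<in>U. card {u \<in> U. r v u}) + (\<Sum>v\<in>U. card {u. r v u \<and> u \<notin> U})"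
      by (simp only: split sum.distrib)
    have "even (\<Sum>v\<in>U. card {u. r v u})" using ev by (intro dvd_sum) auto
    with even_sum_degrees[OF finU sym irrefl] have "even (card ?K)"
      unfolding cut total by (simp only: even_add simp_thms)
    with odd show False by contradiction
  qed
  then obtain v where v: "v \<in> S" "infinite {w. ?q\<^sup>*\<^sup>* v w}"
    using finS unfolding U_def by (meson finite_UN_I)
  then show thesis by (intro that[OF _ v(2)] subsetD[OF SA v(1)])
qed

text \<open>Koenig's lemma in the form of a self-avoiding ray. The invariant along the way is that
  infinitely many vertices can be reached from the current one while avoiding all earlier ones.\<close>

lemma koenig_ray:
  fixes q :: "'v \<Rightarrow> 'v \<Rightarrow> bool"
  assumes fin: "\<And>v. finite {u. q v u}" and inf: "infinite {w. q\<^sup>*\<^sup>* v0 w}"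
  obtains p :: "nat \<Rightarrow> 'v" where "p 0 = v0" "inj p" "\<And>n. q (p n) (p (Suc n))"
proof -
  let ?av = "\<lambda>F a b. q a b \<and> b \<notin> F"
  let ?inf = "\<lambda>v F. infinite {w. (?av F)\<^sup>*\<^sup>* v w}"
  \<comment> \<open>A walk from \<open>w\<close> may be started at its last visit to \<open>w\<close>, so avoiding \<open>w\<close> later on costs nothing.\<close>
  have restrict: "(?av (insert w F))\<^sup>*\<^sup>* w u" if "(?av F)\<^sup>*\<^sup>* w u" for w u F
    using that
  proof induction
    case (step b c)
    show ?case
    proof (cases "c = w")
      case False
      then show ?thesis using step by (intro rtranclp.rtrancl_into_rtrancl[OF step.IH]) auto
    qed simp
  qed simp
  have ext: "\<exists>w. q v w \<and> w \<notin> F \<and> ?inf w (insert w F)" if "?inf v F" for v F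
  proof (rule ccontr)
    assume none: "\<not> ?thesis"
    have "{u. (?av F)\<^sup>*\<^sup>* v u}
        \<subseteq> insert v (\<Union>w\<in>{w. q v w \<and> w \<notin> F}. {u. (?av (insert w F))\<^sup>*\<^sup>* w u})"
      (is "_ \<subseteq> ?B")
    proof
      fix u assume "u \<in> {u. (?av F)\<^sup>*\<^sup>* v u}"
      then have "(?av F)\<^sup>*\<^sup>* v u" by simp
      then show "u \<in> ?B"
      proof (cases rule: converse_rtranclpE)
        case (step w)
        then have "(?av (insert w F))\<^sup>*\<^sup>* w u" by (intro restrict) auto
        then show ?thesis using step(1) by blast
      qed simp
    qed
    moreover have "finite ?B"
      using none fin[of v] by (auto intro!: finite_UN_I elim: rev_finite_subset)
    ultimately show False using that finite_subset by blast
  qed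
  have start: "?inf v0 {v0}"
  proof -
    have "{w. q\<^sup>*\<^sup>* v0 w} \<subseteq> {w. (?av {v0})\<^sup>*\<^sup>* v0 w}" using restrict[of "{}" v0] by auto
    then show ?thesis using inf finite_subset by blast
  qed
  have "\<exists>f. \<forall>n. (fst (f n) \<in> snd (f n) \<and> ?inf (fst (f n)) (snd (f n)) \<and> (n = 0 \<longrightarrow> f n = (v0, {v0})))
      \<and> (q (fst (f n)) (fst (f (Suc n))) \<and> fst (f (Suc n)) \<notin> snd (f n)
         \<and> snd (f (Suc n)) = insert (fst (f (Suc n))) (snd (f n)))"
  proof (rule dependent_nat_choice, goal_cases)
    case 1
    show ?case using start by (intro exI[of _ "(v0, {v0})"]) simp
  next
    case (2 x n)
    then obtain w where "q (fst x) w" "w \<notin> snd x" "?inf w (insert w (snd x))" using ext by blast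
    then show ?case by (intro exI[of _ "(w, insert w (snd x))"]) simp
  qed
  then obtain f where f0: "f 0 = (v0, {v0})" and fin': "\<And>n. fst (f n) \<in> snd (f n)"
    and fq: "\<And>n. q (fst (f n)) (fst (f (Suc n)))" and fnew: "\<And>n. fst (f (Suc n)) \<notin> snd (f n)"
    and fS: "\<And>n. snd (f (Suc n)) = insert (fst (f (Suc n))) (snd (f n))"
    by blast
  have mono: "snd (f m) \<subseteq> snd (f n)" if "m \<le> n" for m n
    by (rule lift_Suc_mono_le[of "\<lambda>n. snd (f n)", OF _ that]) (subst fS, blast)
  have "fst (f m) \<noteq> fst (f n)" if "m < n" for m n
  proof -
    obtain n' where "n = Suc n'" "m \<le> n'" using \<open>m < n\<close> by (cases n) auto
    then show ?thesis using fnew[of n'] fin'[of m] mono[of m n'] by auto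
  qed
  then have "inj (\<lambda>n. fst (f n))" by (intro linorder_injI) auto
  then show thesis using that[of "\<lambda>n. fst (f n)"] f0 fq by auto
qed

text \<open>A shortest walk from one ray to the other is simple and meets each ray only at its
  respective end, so gluing it between the two tails gives a simple two-way infinite path.\<close>

lemma join_rays:
  fixes r :: "'v \<Rightarrow> 'v \<Rightarrow> bool" and p q :: "nat \<Rightarrow> 'v"
  assumes sym: "symp r"
    and p: "inj p" "\<And>n. r (p n) (p (Suc n))" and q: "inj q" "\<And>n. r (q n) (q (Suc n))"
    and disj: "range p \<inter> range q = {}" and conn: "r\<^sup>*\<^sup>* (p 0) (q 0)"
  shows "\<exists>(f :: int \<Rightarrow> 'v) a b. inj f \<and> (\<forall>n. r (f n) (f (n + 1)))
    \<and> (\<forall>n. p (a + n) \<in> range f) \<and> (\<forall>n. q (b + n) \<in> range f)"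
proof -
  define walk where "walk l w \<longleftrightarrow> w 0 \<in> range p \<and> w l \<in> range q \<and> (\<forall>i<l. r (w i) (w (Suc i)))"
    for l :: nat and w :: "nat \<Rightarrow> 'v"
  have ex: "\<exists>l w. walk l w"
  proof -
    obtain n where "(r ^^ n) (p 0) (q 0)" using conn by (auto simp: rtranclp_power)
    then obtain w where "w 0 = p 0" "w n = q 0" "\<forall>i<n. r (w i) (w (Suc i))"
      by (auto simp: relpowp_fun_conv)
    then have "walk n w" by (auto simp: walk_def)
    then show ?thesis by blast
  qed
  define l where "l = (LEAST l. \<exists>w. walk l w)"
  obtain w where w: "walk l w" unfolding l_def using LeastI_ex[OF ex] by blast
  have least: "l \<le> m" if "walk m w'" for m w' unfolding l_def using that by (intro Least_le) blast
  obtain a where a: "w 0 = p a" using w by (auto simp: walk_def)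
  obtain b where b: "w l = q b" using w by (auto simp: walk_def)
  have wp: "w i \<notin> range p" if "0 < i" "i \<le> l" for i
  proof
    assume "w i \<in> range p"
    then have "walk (l - i) (\<lambda>j. w (i + j))" using w that by (auto simp: walk_def)
    then show False using least[of "l - i" "\<lambda>j. w (i + j)"] that by auto
  qed
  have wq: "w i \<notin> range q" if "i < l" for i
  proof
    assume "w i \<in> range q"
    then have "walk i w" using w that by (auto simp: walk_def)
    then show False using least[of i w] that by auto
  qed
  have winj: "w i \<noteq> w j" if "i < j" "j \<le> l" for i j
  proof
    assume eq: "w i = w j"
    let ?w = "\<lambda>t. if t \<le> i then w t else w (t + (j - i))"
    \<comment> \<open>Cutting out the closed part between the times \<open>i\<close> and \<open>j\<close> contradicts minimality.\<close>
    have "r (?w t) (?w (Suc t))" if "t < l - (j - i)" for t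
    proof (cases "t = i")
      case True
      then have "r (w j) (w (Suc j))" using w that \<open>i < j\<close> by (auto simp: walk_def)
      then show ?thesis using True eq \<open>i < j\<close> by auto
    next
      case False
      then show ?thesis using w that \<open>i < j\<close> \<open>j \<le> l\<close> by (auto simp: walk_def)
    qed
    moreover have "?w (l - (j - i)) = w l" using \<open>i < j\<close> \<open>j \<le> l\<close> eq by (cases "j = l") auto
    ultimately have "walk (l - (j - i)) ?w" using w by (auto simp: walk_def)
    then show False using least \<open>i < j\<close> \<open>j \<le> l\<close> by fastforce
  qed
  define f where "f n = (if n < 0 then p (a + nat (- n)) else if n \<le> int l then w (nat n)
      else q (b + nat (n - int l)))" for n :: int
  have "f m \<noteq> f n" if "m < n" for m n
  proof -
    consider "n < 0" | "m < 0" "0 \<le> n" "n \<le> int l" | "m < 0" "int l < n"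
      | "0 \<le> m" "n \<le> int l" | "0 \<le> m" "m \<le> int l" "int l < n" | "int l < m" using that
      by (smt (verit))
    then show ?thesis
    proof cases
      case 1
      then show ?thesis using that p(1) by (auto simp: f_def inj_eq)
    next
      case 2
      show ?thesis
      proof (cases "n = 0")
        case True
        then show ?thesis using 2 p(1) a by (auto simp: f_def inj_eq)
      next
        case False
        then have "w (nat n) \<notin> range p" using 2 by (intro wp) auto
        moreover have "f m \<in> range p" "f n = w (nat n)" using 2 by (auto simp: f_def)
        ultimately show ?thesis by metis
      qed
    next
      case 3
      then show ?thesis using disj by (auto simp: f_def)
    next
      case 4
      then show ?thesis using that winj[of "nat m" "nat n"] by (auto simp: f_def)
    next
      case 5
      show ?thesis
      proof (cases "m = int l")
        case True
        then show ?thesis using 5 q(1) b by (auto simp: f_def inj_eq)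
      next
        case False
        then have "w (nat m) \<notin> range q" using 5 by (intro wq) auto
        moreover have "f n \<in> range q" "f m = w (nat m)" using 5 by (auto simp: f_def)
        ultimately show ?thesis by metis
      qed
    next
      case 6
      then show ?thesis using that q(1) by (auto simp: f_def inj_eq)
    qed
  qed
  then have "inj f" by (intro linorder_injI) auto
  moreover have "r (f n) (f (n + 1))" for n
  proof -
    consider "n < - 1" | "n = - 1" | "0 \<le> n" "n < int l" | "n = int l" | "int l < n" by linarith
    then show ?thesis
    proof cases
      case 1
      then have "nat (- n) = Suc (nat (- (n + 1)))" by linarith
      then show ?thesis using 1 sympD[OF sym p(2)[of "a + nat (- (n + 1))"]] by (simp add: f_def)
    next
      case 2
      then show ?thesis using a sympD[OF sym p(2)[of a]] by (simp add: f_def)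
    next
      case 3
      then have "nat (n + 1) = Suc (nat n)" "nat n < l" by linarith+
      then show ?thesis using 3 w by (auto simp: f_def walk_def)
    next
      case 4
      then show ?thesis using b q(2)[of b] by (auto simp: f_def)
    next
      case 5
      then have "nat (n + 1 - int l) = Suc (nat (n - int l))" by linarith
      then show ?thesis using 5 q(2) by (auto simp: f_def)
    qed
  qed
  moreover have "p (a + n) \<in> range f" for n
  proof -
    have "f (- int n) = p (a + n)" using a by (auto simp: f_def)
    then show ?thesis by (metis rangeI)
  qed
  moreover have "q (b + n) \<in> range f" for n
  proof -
    have "f (int l + int n) = q (b + n)" using b by (cases "n = 0") (auto simp: f_def)
    then show ?thesis by (metis rangeI)
  qed
  ultimately show ?thesis by blast
qed

text \<open>The odd cut at height zero leaves an infinite part of the graph on both of its sides, hence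
  a ray in each. A ray that stays on one side of the cut must be unbounded there because the graph
  has finitely many vertices in every bounded range of heights. Connectedness is what allows the
  two rays to be joined. A limit of finite crossing paths would not do: it may return to the end
  that it came from.\<close>

lemma two_way_path_of_odd_cut:
  fixes r :: "'v \<Rightarrow> 'v \<Rightarrow> bool" and h :: "'v \<Rightarrow> int"
  assumes sym: "symp r" and irrefl: "irreflp r"
    and fin: "\<And>v. finite {u. r v u}" and ev: "\<And>v. even (card {u. r v u})"
    and conn: "\<And>u u' v v'. r u u' \<Longrightarrow> r v v' \<Longrightarrow> r\<^sup>*\<^sup>* u v"
    and odd: "odd (card {(v, u). 0 \<le> h v \<and> h u < 0 \<and> r v u})"
    and layers: "\<And>a b. finite {v. (\<exists>u. r v u) \<and> a \<le> h v \<and> h v \<le> b}"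
  obtains f :: "int \<Rightarrow> 'v" where "inj f" "\<And>n. r (f n) (f (n + 1))"
    "\<And>b. \<exists>n. h (f n) > b" "\<And>b. \<exists>n. h (f n) < b"
proof -
  have ray: "\<exists>p :: nat \<Rightarrow> 'v. inj p \<and> (\<forall>n. r (p n) (p (Suc n)) \<and> p n \<in> A)"
    if oddA: "odd (card {(v, u). v \<in> A \<and> u \<notin> A \<and> r v u})" for A
  proof -
    obtain v where v: "v \<in> A" "infinite {w. (\<lambda>a b. r a b \<and> b \<in> A)\<^sup>*\<^sup>* v w}"
      by (rule infinite_side_of_odd_cut[of r A, OF sym irrefl fin ev oddA]) blast+
    have "finite {u. r w u \<and> u \<in> A}" for w using fin[of w] by (auto elim: rev_finite_subset)
    from koenig_ray[OF this v(2)] obtain p where p: "p 0 = v" "inj p"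
      "\<And>n. r (p n) (p (Suc n)) \<and> p (Suc n) \<in> A" by blast
    moreover have "p n \<in> A" for n using p(1) p(3)[of "n - 1"] v(1) by (cases n) auto
    ultimately show ?thesis by blast
  qed
  have "{(v, u). v \<in> {v. 0 \<le> h v} \<and> u \<notin> {v. 0 \<le> h v} \<and> r v u}
      = {(v, u). 0 \<le> h v \<and> h u < 0 \<and> r v u}" by auto
  with ray[of "{v. 0 \<le> h v}"] odd obtain p
    where p: "inj p" "\<And>n. r (p n) (p (Suc n))" "\<And>n. 0 \<le> h (p n)" by (auto)
  have "{(v, u). v \<in> {v. h v < 0} \<and> u \<notin> {v. h v < 0} \<and> r v u}
      = {(v, u). 0 \<le> h v \<and> h u < 0 \<and> r v u}\<inverse>" (is "?L = ?R\<inverse>")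
  proof (intro equalityI subrelI)
    show "(v, u) \<in> ?R\<inverse>" if "(v, u) \<in> ?L" for v u using that sympD[OF sym, of v u] by simp
    show "(v, u) \<in> ?L" if "(v, u) \<in> ?R\<inverse>" for v u using that sympD[OF sym, of u v] by simp
  qed
  then have "card ?L = card ?R" by (simp add: card_inverse)
  with ray[of "{v. h v < 0}"] odd obtain q
    where q: "inj q" "\<And>n. r (q n) (q (Suc n))" "\<And>n. h (q n) < 0" by (auto)
  have disj: "range p \<inter> range q = {}"
  proof -
    have "p m \<noteq> q n" for m n using p(3)[of m] q(3)[of n] by auto
    then show ?thesis by blast
  qed
  have "r\<^sup>*\<^sup>* (p 0) (q 0)" using conn[OF p(2) q(2)] .
  from join_rays[OF sym p(1,2) q(1,2) disj this] obtain f :: "int \<Rightarrow> 'v" and a b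
    where "inj f \<and> (\<forall>n. r (f n) (f (n + 1)))
      \<and> (\<forall>n. p (a + n) \<in> range f) \<and> (\<forall>n. q (b + n) \<in> range f)"
    by blast
  then have f: "inj f" "\<And>n. r (f n) (f (n + 1))"
    "\<And>n. p (a + n) \<in> range f" "\<And>n. q (b + n) \<in> range f"
    by simp_all
  have up: "\<exists>n. h (f n) > c" for c
  proof (rule ccontr)
    assume "\<not> ?thesis"
    then have "h (p (a + n)) \<le> c" for n using f(3)[of n] by (auto simp: not_less)
    then have "range (\<lambda>n. p (a + n)) \<subseteq> {v. (\<exists>u. r v u) \<and> 0 \<le> h v \<and> h v \<le> c}"
      using p(2,3) by blast
    then have "finite (range (\<lambda>n. p (a + n)))" using layers finite_subset by blast
    moreover have "inj (\<lambda>n. p (a + n))" using p(1) by (auto intro!: injI dest!: injD)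
    ultimately show False using range_inj_infinite by blast
  qed
  have down: "\<exists>n. h (f n) < c" for c
  proof (rule ccontr)
    assume "\<not> ?thesis"
    then have "c \<le> h (q (b + n))" for n using f(4)[of n] by (auto simp: not_less)
    then have "range (\<lambda>n. q (b + n)) \<subseteq> {v. (\<exists>u. r v u) \<and> c \<le> h v \<and> h v \<le> 0}"
      using q(2,3) by (auto intro: less_imp_le)
    then have "finite (range (\<lambda>n. q (b + n)))" using layers finite_subset by blast
    moreover have "inj (\<lambda>n. q (b + n))" using q(1) by (auto intro!: injI dest!: injD)
    ultimately show False using range_inj_infinite by blast
  qed
  show thesis by (rule that[OF f(1,2) up down])
qed

section \<open>Domain walls in the strip\<close>

text \<open>Horizontal and vertical edges, named by their left or lower end. A plaquette is named by its
  lower left corner, hence is a point of the same integer grid, and so the dual of a horizontal edge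
  is literally a vertical one and vice versa.\<close>

definition hedge :: "int \<Rightarrow> int \<Rightarrow> edge" where "hedge x y = {(x, y), (x + 1, y)}"

definition vedge :: "int \<Rightarrow> int \<Rightarrow> edge" where "vedge x y = {(x, y), (x, y + 1)}"

lemma hedge_eq_iff [simp]: "hedge x y = hedge x' y' \<longleftrightarrow> x = x' \<and> y = y'"
  by (auto simp: hedge_def doubleton_eq_iff)

lemma vedge_eq_iff [simp]: "vedge x y = vedge x' y' \<longleftrightarrow> x = x' \<and> y = y'"
  by (auto simp: vedge_def doubleton_eq_iff)

lemma hedge_neq_vedge [simp]: "hedge x y \<noteq> vedge x' y'" "vedge x' y' \<noteq> hedge x y"
  by (auto simp: hedge_def vedge_def doubleton_eq_iff)

lemma spin_product_hedge: "spin_product \<sigma> (hedge x y) = \<sigma> (x, y) * \<sigma> (x + 1, y)"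
  by (simp add: spin_product_def hedge_def)

lemma spin_product_vedge: "spin_product \<sigma> (vedge x y) = \<sigma> (x, y) * \<sigma> (x, y + 1)"
  by (simp add: spin_product_def vedge_def)

lemma hedge_in_edges: "hedge x y \<in> edges V \<longleftrightarrow> (x, y) \<in> V \<and> (x + 1, y) \<in> V"
proof
  assume "(x, y) \<in> V \<and> (x + 1, y) \<in> V"
  moreover have "adjacent (x, y) (x + 1, y)" by (simp add: adjacent_def)
  ultimately show "hedge x y \<in> edges V" unfolding edges_def hedge_def by blast
qed (auto simp: edges_def hedge_def doubleton_eq_iff)

lemma vedge_in_edges: "vedge x y \<in> edges V \<longleftrightarrow> (x, y) \<in> V \<and> (x, y + 1) \<in> V"
proof
  assume "(x, y) \<in> V \<and> (x, y + 1) \<in> V"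
  moreover have "adjacent (x, y) (x, y + 1)" by (simp add: adjacent_def)
  ultimately show "vedge x y \<in> edges V" unfolding edges_def vedge_def by blast
qed (auto simp: edges_def vedge_def doubleton_eq_iff)

lemma edges_cases:
  assumes "e \<in> edges V"
  obtains (h) x y where "e = hedge x y" "(x, y) \<in> V" "(x + 1, y) \<in> V"
    | (v) x y where "e = vedge x y" "(x, y) \<in> V" "(x, y + 1) \<in> V"
proof -
  obtain a b c d where e: "e = {(a, b), (c, d)}" "(a, b) \<in> V" "(c, d) \<in> V"
    and "\<bar>a - c\<bar> + \<bar>b - d\<bar> = 1"
    using assms by (auto simp: edges_def adjacent_def)
  then consider "c = a + 1" "d = b" | "c = a - 1" "d = b" | "c = a" "d = b + 1" | "c = a" "d = b - 1"
    by (smt (verit))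
  then show thesis
  proof cases
    case 1
    then show ?thesis using h[of a b] e by (auto simp: hedge_def)
  next
    case 2
    then show ?thesis using h[of c b] e by (auto simp: hedge_def)
  next
    case 3
    then show ?thesis using v[of a b] e by (auto simp: vedge_def)
  next
    case 4
    then show ?thesis using v[of a d] e by (auto simp: vedge_def)
  qed
qed

lemma plaquettes_containing_hedge:
  "plaquettes_containing V (hedge x y) = {(x, y - 1), (x, y)} \<inter> plaquettes V"
  by (auto simp: plaquettes_containing_def hedge_def corners_def)

lemma plaquettes_containing_vedge:
  "plaquettes_containing V (vedge x y) = {(x - 1, y), (x, y)} \<inter> plaquettes V"
  by (auto simp: plaquettes_containing_def vedge_def corners_def)

lemma plaquettes_rectangle: "plaquettes ({a..b} \<times> {c..d}) = {a..<b} \<times> {c..<d}"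
  by (auto simp: plaquettes_def corners_def)

lemma plaquettes_strip: "plaquettes (strip k) = {- k..<k} \<times> UNIV"
  by (auto simp: plaquettes_def corners_def strip_def)

lemma in_strip: "(x, y) \<in> strip k \<longleftrightarrow> - k \<le> x \<and> x \<le> k"
  by (auto simp: strip_def)

text \<open>As no coupling vanishes, the two states disagree about an edge exactly if their product
  \<open>\<eta>\<close> changes across it; the differing dual edges form the contour separating the two signs
  of \<open>\<eta>\<close>.\<close>

lemma differing_dual_edges_eq:
  fixes k :: int
  assumes k: "k \<ge> 1" and J: "\<And>e. e \<in> edges (strip k) \<Longrightarrow> J e \<noteq> 0"
    and \<sigma>: "is_state (strip k) \<sigma>" and \<tau>: "is_state (strip k) \<tau>"
    and \<eta>: "\<And>v. \<eta> v = \<sigma> v * \<tau> v"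
  shows "differing_dual_edges J k \<sigma> \<tau> =
    {vedge x (y - 1) | x y. - k \<le> x \<and> x < k \<and> \<eta> (x, y) \<noteq> \<eta> (x + 1, y)} \<union>
    {hedge (x - 1) y | x y. - k < x \<and> x < k \<and> \<eta> (x, y) \<noteq> \<eta> (x, y + 1)}" (is "_ = ?D")
proof -
  have st: "\<sigma> (x, y) = 1 \<or> \<sigma> (x, y) = - 1" "\<tau> (x, y) = 1 \<or> \<tau> (x, y) = - 1"
    if "- k \<le> x" "x \<le> k" for x y
    using that \<sigma> \<tau> by (auto simp: is_state_def in_strip)
  have hor: "satisfied J \<sigma> (hedge x y) \<noteq> satisfied J \<tau> (hedge x y) \<longleftrightarrow> \<eta> (x, y) \<noteq> \<eta> (x + 1, y)"
    if "- k \<le> x" "x < k" for x y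
  proof -
    have "J (hedge x y) \<noteq> 0" using that by (intro J) (auto simp: hedge_in_edges in_strip)
    then show ?thesis using that st[of x y] st[of "x + 1" y]
      by (auto simp: satisfied_def spin_product_hedge \<eta>)
  qed
  have ver: "satisfied J \<sigma> (vedge x y) \<noteq> satisfied J \<tau> (vedge x y) \<longleftrightarrow> \<eta> (x, y) \<noteq> \<eta> (x, y + 1)"
    if "- k \<le> x" "x \<le> k" for x y
  proof -
    have "J (vedge x y) \<noteq> 0" using that by (intro J) (auto simp: vedge_in_edges in_strip)
    then show ?thesis using that st[of x y] st[of x "y + 1"]
      by (auto simp: satisfied_def spin_product_vedge \<eta>)
  qed
  have ph: "plaquettes_containing (strip k) (hedge x y) = vedge x (y - 1)" if "- k \<le> x" "x < k" for x y
    using that by (auto simp: plaquettes_containing_hedge plaquettes_strip vedge_def)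
  have pv: "plaquettes_containing (strip k) (vedge x y) = hedge (x - 1) y" if "- k < x" "x < k" for x y
    using that by (auto simp: plaquettes_containing_vedge plaquettes_strip hedge_def)
  have bh: "hedge x y \<notin> boundary_edges (strip k)" if "- k \<le> x" "x < k" for x y
    using ph[OF that] by (simp add: boundary_edges_def vedge_def)
  have bv: "vedge x y \<in> boundary_edges (strip k) \<longleftrightarrow> \<not> (- k < x \<and> x < k)"
    if "- k \<le> x" "x \<le> k" for x y
  proof (cases "- k < x \<and> x < k")
    case True
    then show ?thesis using pv[of x y] by (simp add: boundary_edges_def hedge_def)
  next
    case False
    then have "x = - k \<or> x = k" using that by auto
    then have "plaquettes_containing (strip k) (vedge x y) = {(if x = k then x - 1 else x, y)}"
      using k by (auto simp: plaquettes_containing_vedge plaquettes_strip)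
    then show ?thesis using that False by (simp add: boundary_edges_def vedge_in_edges in_strip)
  qed
  have E: "{e \<in> edges (strip k) - boundary_edges (strip k). satisfied J \<sigma> e \<noteq> satisfied J \<tau> e} =
    {hedge x y | x y. - k \<le> x \<and> x < k \<and> \<eta> (x, y) \<noteq> \<eta> (x + 1, y)} \<union>
    {vedge x y | x y. - k < x \<and> x < k \<and> \<eta> (x, y) \<noteq> \<eta> (x, y + 1)}" (is "?L = ?H \<union> ?V")
  proof (intro equalityI subsetI)
    fix e assume e: "e \<in> ?L"
    then have "e \<in> edges (strip k)" by blast
    then show "e \<in> ?H \<union> ?V"
    proof (cases rule: edges_cases)
      case (h x y)
      then show ?thesis using e hor[of x y] by (auto simp: in_strip)
    next
      case (v x y)
      then show ?thesis using e ver[of x y] bv[of x y] by (auto simp: in_strip)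
    qed
  next
    fix e assume "e \<in> ?H \<union> ?V"
    then show "e \<in> ?L"
    proof
      assume "e \<in> ?H"
      then obtain x y where "e = hedge x y" "- k \<le> x" "x < k" "\<eta> (x, y) \<noteq> \<eta> (x + 1, y)" by blast
      then show ?thesis using hor[of x y] bh[of x y] by (auto simp: hedge_in_edges in_strip)
    next
      assume "e \<in> ?V"
      then obtain x y where "e = vedge x y" "- k < x" "x < k" "\<eta> (x, y) \<noteq> \<eta> (x, y + 1)" by blast
      then show ?thesis using ver[of x y] bv[of x y] by (auto simp: vedge_in_edges in_strip)
    qed
  qed
  have "plaquettes_containing (strip k) ` ?H =
      {vedge x (y - 1) | x y. - k \<le> x \<and> x < k \<and> \<eta> (x, y) \<noteq> \<eta> (x + 1, y)}"
    unfolding setcompr_eq_image by (force simp: ph image_iff)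
  moreover have "plaquettes_containing (strip k) ` ?V =
      {hedge (x - 1) y | x y. - k < x \<and> x < k \<and> \<eta> (x, y) \<noteq> \<eta> (x, y + 1)}"
    unfolding setcompr_eq_image by (force simp: pv image_iff)
  ultimately show ?thesis unfolding differing_dual_edges_def E image_Un by simp
qed

lemma odd_sign_changes:
  fixes g :: "int \<Rightarrow> real"
  assumes "a \<le> b" "\<And>x. a \<le> x \<Longrightarrow> x \<le> b \<Longrightarrow> g x \<in> {- 1, 1}"
  shows "odd (card {x. a \<le> x \<and> x < b \<and> g x \<noteq> g (x + 1)}) \<longleftrightarrow> g a \<noteq> g b"
  using assms
proof (induction b rule: int_ge_induct)
  case base
  have "{x. a \<le> x \<and> x < a \<and> g x \<noteq> g (x + 1)} = {}" by auto
  then show ?case by (simp only: card.empty) simp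
next
  case (step b)
  let ?S = "\<lambda>b. {x. a \<le> x \<and> x < b \<and> g x \<noteq> g (x + 1)}"
  have "?S (b + 1) = ?S b \<union> (if g b \<noteq> g (b + 1) then {b} else {})"
    using step.hyps by (auto simp: order_less_le)
  moreover have "finite (?S b)" by (rule finite_subset[of _ "{a..b}"]) auto
  ultimately have "card (?S (b + 1)) = card (?S b) + of_bool (g b \<noteq> g (b + 1))"
    by simp
  moreover have "odd (card (?S b)) \<longleftrightarrow> g a \<noteq> g b" using step by auto
  moreover have "g a \<in> {-1, 1}" "g b \<in> {-1, 1}" "g (b + 1) \<in> {-1, 1}" using step.prems step.hyps by auto
  ultimately show ?case by auto
qed

text \<open>Going once around a plaquette, \<open>\<eta>\<close> returns to its value, so contours have even
  degree.\<close>

lemma even_changes_around_square: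
  fixes a b c d :: real
  assumes "a \<in> {- 1, 1}" "b \<in> {- 1, 1}" "c \<in> {- 1, 1}" "d \<in> {- 1, 1}"
  shows "even (of_bool (b \<noteq> d) + of_bool (a \<noteq> c) + of_bool (c \<noteq> d) + of_bool (a \<noteq> b) :: nat)"
  using assms by auto

lemma component_connected:
  assumes W: "W \<in> edge_components D" and two: "\<forall>d\<in>D. \<exists>u v. d = {u, v} \<and> u \<noteq> v"
    and u: "{u, u'} \<in> W" and v: "{v, v'} \<in> W"
  shows "(\<lambda>u v. {u, v} \<in> W)\<^sup>*\<^sup>* u v"
proof -
  let ?R = "{(x, y). x \<in> D \<and> y \<in> D \<and> x \<inter> y \<noteq> {}}"
  let ?r = "\<lambda>u v. {u, v} \<in> W"
  obtain w where w: "w \<in> D" "W = ?R\<^sup>* `` {w}" using W unfolding edge_components_def by (rule quotientE)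
  have WD: "d \<in> D" if "d \<in> W" for d
  proof -
    have "(w, d) \<in> ?R\<^sup>*" using that w by auto
    then show ?thesis using w(1) by (cases rule: rtranclE) auto
  qed
  have within: "?r\<^sup>*\<^sup>* a b" if "d \<in> W" "a \<in> d" "b \<in> d" for a b d
  proof (cases "a = b")
    case False
    obtain x y where "d = {x, y}" "x \<noteq> y" using two WD \<open>d \<in> W\<close> by meson
    then have "d = {a, b}" using that False by auto
    then show ?thesis using that by (auto intro!: r_into_rtranclp)
  qed simp
  have reach: "\<forall>a\<in>w. \<forall>b\<in>d. ?r\<^sup>*\<^sup>* a b" if "(w, d) \<in> ?R\<^sup>*" for d
    using that
  proof (induction rule: rtrancl_induct)
    case base
    then show ?case using within[of w] w by auto
  next
    case (step d d')
    then obtain c where c: "c \<in> d" "c \<in> d'" by blast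
    have "d' \<in> W" using step.hyps w by (auto intro: rtrancl_into_rtrancl)
    show ?case
    proof (intro ballI)
      fix a b assume "a \<in> w" "b \<in> d'"
      then have "?r\<^sup>*\<^sup>* a c" "?r\<^sup>*\<^sup>* c b" using step.IH c within[OF \<open>d' \<in> W\<close> c(2)] by auto
      then show "?r\<^sup>*\<^sup>* a b" by (rule rtranclp_trans)
    qed
  qed
  obtain z where z: "z \<in> w" using two w(1) by blast
  have "?r\<^sup>*\<^sup>* z u" using reach[of "{u, u'}"] u w z by auto
  moreover have "symp ?r" by (auto intro!: sympI simp: insert_commute)
  ultimately have "?r\<^sup>*\<^sup>* u z" by (meson symp_rtranclp sympD)
  moreover have "?r\<^sup>*\<^sup>* z v" using reach[of "{v, v'}"] v w z by auto
  ultimately show ?thesis by (rule rtranclp_trans)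
qed

lemma edge_component_subset: "W \<in> edge_components D \<Longrightarrow> W \<subseteq> D"
proof -
  assume "W \<in> edge_components D"
  then obtain w where "w \<in> D" "W = {(x, y). x \<in> D \<and> y \<in> D \<and> x \<inter> y \<noteq> {}}\<^sup>* `` {w}"
    unfolding edge_components_def by (rule quotientE)
  then show ?thesis by (auto elim: rtranclE)
qed

lemma edge_component_closed:
  assumes "W \<in> edge_components D" "d \<in> W" "d' \<in> D" "d \<inter> d' \<noteq> {}"
  shows "d' \<in> W"
proof -
  obtain w where w: "w \<in> D" "W = {(x, y). x \<in> D \<and> y \<in> D \<and> x \<inter> y \<noteq> {}}\<^sup>* `` {w}"
    using assms(1) unfolding edge_components_def by (rule quotientE)
  have "d \<in> D" using edge_component_subset[OF assms(1)] assms(2) by blast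
  then have "(d, d') \<in> {(x, y). x \<in> D \<and> y \<in> D \<and> x \<inter> y \<noteq> {}}" using assms by blast
  then show ?thesis using assms(2) unfolding w(2) by (auto intro: rtrancl_into_rtrancl)
qed

text \<open>An odd set of edges cannot be partitioned into even parts by the components.\<close>

lemma odd_component:
  assumes K: "K \<subseteq> D" "finite K" "odd (card K)"
  obtains W where "W \<in> edge_components D" "odd (card (W \<inter> K))"
proof -
  let ?R = "{(x, y). x \<in> D \<and> y \<in> D \<and> x \<inter> y \<noteq> {}}"
  let ?Q = "?R\<^sup>* \<inter> K \<times> K"
  have "sym (?R\<^sup>*)" by (intro sym_rtrancl) (auto simp: sym_def)
  then have "equiv K ?Q"
    by (intro equivI refl_onI symI transI) (auto dest: symD intro: rtrancl_trans)
  then obtain X where X: "X \<in> K // ?Q" "odd (card X)"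
    using equiv_imp_dvd_card[of K ?Q 2] K by blast
  then obtain e where e: "e \<in> K" "X = ?Q `` {e}" by (auto elim: quotientE)
  then have "X = ?R\<^sup>* `` {e} \<inter> K" by auto
  moreover have "?R\<^sup>* `` {e} \<in> edge_components D"
    unfolding edge_components_def using e K by (intro quotientI) auto
  ultimately show thesis using that X(2) by simp
qed

text \<open>The product \<open>\<eta>\<close> of the two states is constant along each side of the strip, with opposite
  signs on the two sides. So an odd number of contour edges crosses row zero, some domain wall
  \<open>W\<close> takes an odd share of them, and \<open>W\<close> inherits even degrees from the full contour. Constancy
  along the sides matters here: the sides are not crossed by dual edges, and a change of \<open>\<eta>\<close> there
  would let a contour end.\<close>

lemma finitely_incongruentI:
  fixes k :: int
  assumes k: "k \<ge> 1" and J: "\<And>e. e \<in> edges (strip k) \<Longrightarrow> J e \<noteq> 0"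
    and \<sigma>: "is_state (strip k) \<sigma>" and \<tau>: "is_state (strip k) \<tau>"
    and sides: "\<And>x y. x \<in> {- k, k} \<Longrightarrow> satisfied J \<sigma> (vedge x y) \<and> satisfied J \<tau> (vedge x y)"
    and ends: "\<sigma> (- k, 0) * \<sigma> (k, 0) \<noteq> \<tau> (- k, 0) * \<tau> (k, 0)"
  shows "finitely_incongruent J k \<sigma> \<tau>"
proof -
  define \<eta> where "\<eta> v = \<sigma> v * \<tau> v" for v
  define D where "D = differing_dual_edges J k \<sigma> \<tau>"
  define H where "H x y \<longleftrightarrow> - k \<le> x \<and> x < k \<and> \<eta> (x, y) \<noteq> \<eta> (x + 1, y)" for x y
  define V where "V x y \<longleftrightarrow> - k < x \<and> x < k \<and> \<eta> (x, y) \<noteq> \<eta> (x, y + 1)" for x y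
  have st: "\<sigma> (x, y) = 1 \<or> \<sigma> (x, y) = - 1" "\<tau> (x, y) = 1 \<or> \<tau> (x, y) = - 1"
    if "- k \<le> x" "x \<le> k" for x y
    using that \<sigma> \<tau> by (auto simp: is_state_def in_strip)
  have \<eta>: "\<eta> (x, y) \<in> {- 1, 1}" if "- k \<le> x" "x \<le> k" for x y
    using st[OF that, of y] by (auto simp: \<eta>_def)
  have side: "\<eta> (x, y) = \<eta> (x, y + 1)" if "x = - k \<or> x = k" for x y
    using sides[of x y] that k st[of x y] st[of x "y + 1"]
    by (auto simp: \<eta>_def satisfied_def spin_product_vedge)
  have D: "D = {vedge x (y - 1) | x y. H x y} \<union> {hedge (x - 1) y | x y. V x y}"
    unfolding D_def H_def V_def by (rule differing_dual_edges_eq[OF k J \<sigma> \<tau> \<eta>_def])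
  have vD: "vedge x y \<in> D \<longleftrightarrow> H x (y + 1)" for x y by (force simp: D)
  have hD: "hedge x y \<in> D \<longleftrightarrow> V (x + 1) y" for x y by (force simp: D)
  have two: "\<exists>u v. d = {u, v} \<and> u \<noteq> v" if "d \<in> D" for d
  proof -
    have "vedge x y = {(x, y), (x, y + 1)} \<and> (x, y) \<noteq> (x, y + 1)"
      "hedge x y = {(x, y), (x + 1, y)} \<and> (x, y) \<noteq> (x + 1, y)" for x y
      by (auto simp: vedge_def hedge_def)
    then show ?thesis using that unfolding D by blast
  qed
  have nb: "{(x, y), q} \<in> D \<longleftrightarrow> q = (x + 1, y) \<and> V (x + 1) y \<or> q = (x - 1, y) \<and> V x y \<or>
      q = (x, y + 1) \<and> H x (y + 1) \<or> q = (x, y - 1) \<and> H x y" for x y q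
  proof
    assume "{(x, y), q} \<in> D"
    then consider a b where "{(x, y), q} = vedge a (b - 1)" "H a b"
      | a b where "{(x, y), q} = hedge (a - 1) b" "V a b" by (auto simp: D)
    then show "q = (x + 1, y) \<and> V (x + 1) y \<or> q = (x - 1, y) \<and> V x y \<or>
        q = (x, y + 1) \<and> H x (y + 1) \<or> q = (x, y - 1) \<and> H x y"
      by cases (auto simp: vedge_def hedge_def doubleton_eq_iff)
  next
    have "{(x, y), (x + 1, y)} = hedge x y" "{(x, y), (x - 1, y)} = hedge (x - 1) y"
      "{(x, y), (x, y + 1)} = vedge x y" "{(x, y), (x, y - 1)} = vedge x (y - 1)"
      by (auto simp: hedge_def vedge_def)
    then show "{(x, y), q} \<in> D" if "q = (x + 1, y) \<and> V (x + 1) y \<or> q = (x - 1, y) \<and> V x y \<or>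
        q = (x, y + 1) \<and> H x (y + 1) \<or> q = (x, y - 1) \<and> H x y"
      using that by (auto simp: vD hD)
  qed
  have nbs: "{q. {(x, y), q} \<in> D} = (if V (x + 1) y then {(x + 1, y)} else {}) \<union>
      (if V x y then {(x - 1, y)} else {}) \<union> (if H x (y + 1) then {(x, y + 1)} else {}) \<union>
      (if H x y then {(x, y - 1)} else {})" for x y
    by (auto simp: nb)
  have finD: "finite {q. {v, q} \<in> D}" for v
    by (cases v) (simp add: nbs)
  have evD: "even (card {q. {v, q} \<in> D})" for v
  proof (cases v)
    case (Pair x y)
    have c: "card {q. {v, q} \<in> D} = of_bool (V (x + 1) y) + of_bool (V x y) + of_bool (H x (y + 1)) + of_bool (H x y)"
      unfolding Pair nbs by simp
    show ?thesis
    proof (cases "- k \<le> x \<and> x < k")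
      case False
      then have "\<not> V (x + 1) y" "\<not> V x y" "\<not> H x (y + 1)" "\<not> H x y" by (auto simp: V_def H_def)
      then show ?thesis by (simp add: c)
    next
      case True
      have V1: "V x y \<longleftrightarrow> \<eta> (x, y) \<noteq> \<eta> (x, y + 1)" using True side[of x y] by (cases "x = - k") (auto simp: V_def)
      have V2: "V (x + 1) y \<longleftrightarrow> \<eta> (x + 1, y) \<noteq> \<eta> (x + 1, y + 1)"
        using True side[of "x + 1" y] by (cases "x + 1 = k") (auto simp: V_def)
      have H: "H x z \<longleftrightarrow> \<eta> (x, z) \<noteq> \<eta> (x + 1, z)" for z using True by (simp add: H_def)
      show ?thesis unfolding c V1 V2 H
        by (rule even_changes_around_square) (use True in \<open>intro \<eta>; simp\<close>)+
    qed
  qed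
  define K where "K = {vedge x (- 1) | x. H x 0}"
  have K: "K = (\<lambda>x. vedge x (- 1)) ` {x. H x 0}" by (auto simp: K_def)
  have "inj_on (\<lambda>x. vedge x (- 1)) A" for A by (auto simp: inj_on_def)
  note card_row = card_image[OF this]
  have "\<eta> (- k, 0) \<noteq> \<eta> (k, 0)"
    using ends st[of "- k" 0] st[of k 0] k by (auto simp: \<eta>_def)
  then have "odd (card {x. H x 0})"
    unfolding H_def using odd_sign_changes[of "- k" k "\<lambda>x. \<eta> (x, 0)"] \<eta> k by simp
  then have "odd (card K)" unfolding K card_row .
  moreover have "K \<subseteq> D" by (auto simp: K_def vD)
  moreover have "finite {x. H x 0}" by (rule finite_subset[of _ "{- k..k}"]) (auto simp: H_def)
  then have "finite K" unfolding K by simp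
  ultimately obtain W where W: "W \<in> edge_components D" "odd (card (W \<inter> K))"
    using odd_component by blast
  have WD: "W \<subseteq> D" by (rule edge_component_subset[OF W(1)])
  define r where "r u v \<longleftrightarrow> {u, v} \<in> W" for u v
  have symr: "symp r" by (auto simp: r_def insert_commute intro!: sympI)
  have irr: "irreflp r"
  proof (rule irreflpI)
    show "\<not> r v v" for v using two[of "{v, v}"] WD by (auto simp: r_def doubleton_eq_iff)
  qed
  have finr: "finite {u. r v u}" for v
    using finD[of v] WD by (auto simp: r_def elim!: rev_finite_subset)
  have evr: "even (card {u. r v u})" for v
  proof (cases "{u. r v u} = {}")
    case True
    then show ?thesis by (simp only: card.empty) simp
  next
    case False
    then obtain u where u: "{v, u} \<in> W" by (auto simp: r_def)
    have "{v, q} \<in> W \<longleftrightarrow> {v, q} \<in> D" for q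
      using edge_component_closed[OF W(1) u, of "{v, q}"] WD by auto
    then show ?thesis using evD[of v] by (simp add: r_def)
  qed
  have connr: "r\<^sup>*\<^sup>* u v" if "r u u'" "r v v'" for u u' v v'
  proof -
    have "\<forall>d\<in>D. \<exists>u v. d = {u, v} \<and> u \<noteq> v" using two by blast
    from component_connected[OF W(1) this that[unfolded r_def]] show ?thesis unfolding r_def .
  qed
  have oddr: "odd (card {(v, u). 0 \<le> snd v \<and> snd u < 0 \<and> r v u})"
  proof -
    let ?X = "{x. vedge x (- 1) \<in> W}"
    let ?c = "\<lambda>x :: int. ((x, 0 :: int), (x, - 1 :: int))"
    have "{(v, u). 0 \<le> snd v \<and> snd u < 0 \<and> r v u} = ?c ` ?X"
    proof (intro equalityI subsetI)
      fix z assume "z \<in> {(v, u). 0 \<le> snd v \<and> snd u < 0 \<and> r v u}"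
      then obtain x y q where z: "z = ((x, y), q)" "0 \<le> y" "snd q < 0" "{(x, y), q} \<in> W"
        by (auto simp: r_def)
      then have "y = 0" "q = (x, - 1)" using nb[of x y q] WD by auto
      moreover have "{(x, 0), (x, - 1)} = vedge x (- 1)" by (auto simp: vedge_def)
      ultimately show "z \<in> ?c ` ?X" using z by auto
    next
      fix z assume "z \<in> ?c ` ?X"
      then show "z \<in> {(v, u). 0 \<le> snd v \<and> snd u < 0 \<and> r v u}"
        by (auto simp: r_def vedge_def insert_commute)
    qed
    moreover have "inj_on ?c ?X" by (auto simp: inj_on_def)
    moreover have "W \<inter> K = (\<lambda>x. vedge x (- 1)) ` ?X" using WD by (auto simp: K_def) (use vD in force)
    ultimately show ?thesis using W(2) by (simp add: card_image card_row)
  qed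
  have layr: "finite {v. (\<exists>u. r v u) \<and> a \<le> snd v \<and> snd v \<le> b}" for a b
  proof (rule finite_subset)
    show "{v. (\<exists>u. r v u) \<and> a \<le> snd v \<and> snd v \<le> b} \<subseteq> {- k..k} \<times> {a..b}"
    proof
      fix v assume "v \<in> {v. (\<exists>u. r v u) \<and> a \<le> snd v \<and> snd v \<le> b}"
      then obtain x y u where "v = (x, y)" "r (x, y) u" "a \<le> y" "y \<le> b" by (cases v) auto
      moreover from this have "{(x, y), u} \<in> D" using WD by (auto simp: r_def)
      ultimately show "v \<in> {- k..k} \<times> {a..b}" by (auto simp: nb V_def H_def)
    qed
  qed simp
  show ?thesis
  proof (rule two_way_path_of_odd_cut[of r snd])
    fix f :: "int \<Rightarrow> plaquette"
    assume "inj f" "\<And>n. r (f n) (f (n + 1))"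
      "\<And>b. \<exists>n. snd (f n) > b" "\<And>b. \<exists>n. snd (f n) < b"
    then show ?thesis
      using W(1) unfolding finitely_incongruent_def domain_walls_def D_def r_def by blast
  qed (rule symr irr finr evr oddr layr | rule connr, assumption+)+
qed

section \<open>Boundary conditions of rectangles\<close>

lemma constant_on_interval:
  fixes g :: "int \<Rightarrow> 'c"
  assumes step: "\<And>x. a \<le> x \<Longrightarrow> x < b \<Longrightarrow> g x = g (x + 1)" and x: "a \<le> x" "x \<le> b"
  shows "g x = g a"
  using x
proof (induction x rule: int_ge_induct)
  case (step x)
  then show ?case using assms(1)[of x] by simp
qed simp

text \<open>Unlike \<open>sgn\<close>, this never vanishes, so the products below are signs for all couplings.\<close>

definition coupling_sign :: "real \<Rightarrow> real" where "coupling_sign a = (if a < 0 then - 1 else 1)"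

lemma coupling_sign_cases: "coupling_sign a = 1 \<or> coupling_sign a = - 1"
  by (simp add: coupling_sign_def)

lemma satisfied_iff_sign:
  assumes "J e \<noteq> 0" "spin_product \<sigma> e = 1 \<or> spin_product \<sigma> e = - 1"
  shows "satisfied J \<sigma> e \<longleftrightarrow> spin_product \<sigma> e = coupling_sign (J e)"
  using assms by (auto simp: satisfied_def coupling_sign_def)

text \<open>One of the two products is empty, depending on the sign of \<open>y\<close>; together they solve the
  recursion \<open>running_sign_step\<close> on all integers.\<close>

definition running_sign :: "(int \<Rightarrow> real) \<Rightarrow> int \<Rightarrow> real" where
  "running_sign s y = (\<Prod>i\<in>{0..<y}. coupling_sign (s i)) * (\<Prod>i\<in>{y..<0}. coupling_sign (s i))"

lemma running_sign_cases: "running_sign s y = 1 \<or> running_sign s y = - 1"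
proof -
  have "(\<Prod>i\<in>A. coupling_sign (s i)) = 1 \<or> (\<Prod>i\<in>A. coupling_sign (s i)) = - 1" for A
  proof (induction A rule: infinite_finite_induct)
    case (insert x F)
    then show ?case using coupling_sign_cases[of "s x"] by auto
  qed auto
  from this[of "{0..<y}"] this[of "{y..<0}"] show ?thesis unfolding running_sign_def by auto
qed

lemma running_sign_square: "running_sign s y * running_sign s y = 1"
  using running_sign_cases[of s y] by auto

lemma running_sign_step: "running_sign s (y + 1) = coupling_sign (s y) * running_sign s y"
proof (cases "0 \<le> y")
  case True
  then have "{0..<y + 1} = insert y {0..<y}" "{y..<0} = {}" "{y + 1..<0} = {}" by auto
  then show ?thesis by (simp add: running_sign_def)
next
  case False
  then have *: "{y..<0} = insert y {y + 1..<0}" "{0..<y + 1} = {}" "{0..<y} = {}" by auto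
  have "running_sign s y = coupling_sign (s y) * running_sign s (y + 1)" unfolding running_sign_def * by simp
  then show ?thesis using coupling_sign_cases[of "s y"] by auto
qed

text \<open>A state satisfies all edges of a line of the lattice precisely if it is a constant multiple
  of the running sign of the couplings along that line.\<close>

definition side_gauge :: "(edge \<Rightarrow> real) \<Rightarrow> int \<Rightarrow> int \<Rightarrow> real" where
  "side_gauge J x = running_sign (\<lambda>y. J (vedge x y))"

definition row_gauge :: "(edge \<Rightarrow> real) \<Rightarrow> int \<Rightarrow> int \<Rightarrow> real" where
  "row_gauge J y = running_sign (\<lambda>x. J (hedge x y))"

text \<open>The sign of the product of the couplings on the path from \<open>(- k, 0)\<close> along the left side to
  row \<open>y\<close>, across the strip, and along the right side back to \<open>(k, 0)\<close>. A state that satisfies all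
  edges of this path has this product of spins at its two ends.\<close>

definition row_sign :: "(edge \<Rightarrow> real) \<Rightarrow> int \<Rightarrow> int \<Rightarrow> real" where
  "row_sign J k y = side_gauge J (- k) y * row_gauge J y (- k) * row_gauge J y k * side_gauge J k y"

lemma row_sign_cases: "row_sign J k y = 1 \<or> row_sign J k y = - 1"
proof -
  have "row_sign J k y \<in> {1, - 1}"
    unfolding row_sign_def side_gauge_def row_gauge_def
    using running_sign_cases[of "\<lambda>y. J (vedge (- k) y)" y] running_sign_cases[of "\<lambda>y. J (vedge k y)" y]
      running_sign_cases[of "\<lambda>x. J (hedge x y)" k] running_sign_cases[of "\<lambda>x. J (hedge x y)" "- k"]
    by (elim disjE; simp)
  then show ?thesis by auto
qed

lemma satisfied_vedge_iff:
  assumes "J (vedge x y) \<noteq> 0" "\<sigma> (x, y) \<in> {- 1, 1}" "\<sigma> (x, y + 1) \<in> {- 1, 1}"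
  shows "satisfied J \<sigma> (vedge x y) \<longleftrightarrow> \<sigma> (x, y) * side_gauge J x y = \<sigma> (x, y + 1) * side_gauge J x (y + 1)"
proof -
  let ?s = "coupling_sign (J (vedge x y))" and ?g = "side_gauge J x y"
  have "side_gauge J x (y + 1) = ?s * ?g" by (simp add: side_gauge_def running_sign_step)
  moreover have "?s = 1 \<or> ?s = - 1" by (rule coupling_sign_cases)
  moreover have "?g = 1 \<or> ?g = - 1" unfolding side_gauge_def by (rule running_sign_cases)
  moreover have "satisfied J \<sigma> (vedge x y) \<longleftrightarrow> \<sigma> (x, y) * \<sigma> (x, y + 1) = ?s"
    using assms by (subst satisfied_iff_sign) (auto simp: spin_product_vedge)
  ultimately show ?thesis using assms(2,3) by (elim disjE insertE) auto
qed

lemma satisfied_hedge_iff: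
  assumes "J (hedge x y) \<noteq> 0" "\<sigma> (x, y) \<in> {- 1, 1}" "\<sigma> (x + 1, y) \<in> {- 1, 1}"
  shows "satisfied J \<sigma> (hedge x y) \<longleftrightarrow> \<sigma> (x, y) * row_gauge J y x = \<sigma> (x + 1, y) * row_gauge J y (x + 1)"
proof -
  let ?s = "coupling_sign (J (hedge x y))" and ?g = "row_gauge J y x"
  have "row_gauge J y (x + 1) = ?s * ?g" by (simp add: row_gauge_def running_sign_step)
  moreover have "?s = 1 \<or> ?s = - 1" by (rule coupling_sign_cases)
  moreover have "?g = 1 \<or> ?g = - 1" unfolding row_gauge_def by (rule running_sign_cases)
  moreover have "satisfied J \<sigma> (hedge x y) \<longleftrightarrow> \<sigma> (x, y) * \<sigma> (x + 1, y) = ?s"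
    using assms by (subst satisfied_iff_sign) (auto simp: spin_product_hedge)
  ultimately show ?thesis using assms(2,3) by (elim disjE insertE) auto
qed

lemma finite_edges: "finite V \<Longrightarrow> finite (edges V)"
proof -
  assume "finite V"
  moreover have "edges V \<subseteq> (\<lambda>(u, v). {u, v}) ` (V \<times> V)" by (auto simp: edges_def)
  ultimately show ?thesis by (meson finite_SigmaI finite_imageI finite_subset)
qed

lemma hedge_boundary_rectangle:
  assumes "a < b" "c < d"
  shows "hedge x y \<in> boundary_edges ({a..b} \<times> {c..d}) \<longleftrightarrow> a \<le> x \<and> x < b \<and> (y = c \<or> y = d)"
proof (cases "a \<le> x \<and> x < b \<and> c \<le> y \<and> y \<le> d")
  case True
  then have "plaquettes_containing ({a..b} \<times> {c..d}) (hedge x y)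
      = (if c < y then {(x, y - 1)} else {}) \<union> (if y < d then {(x, y)} else {})"
    by (auto simp: plaquettes_containing_hedge plaquettes_rectangle)
  then have "card (plaquettes_containing ({a..b} \<times> {c..d}) (hedge x y)) = of_bool (c < y) + of_bool (y < d)"
    by simp
  then show ?thesis using True assms by (auto simp: boundary_edges_def hedge_in_edges)
next
  case False
  then show ?thesis using assms by (auto simp: boundary_edges_def hedge_in_edges)
qed

lemma vedge_boundary_rectangle:
  assumes "a < b" "c < d"
  shows "vedge x y \<in> boundary_edges ({a..b} \<times> {c..d}) \<longleftrightarrow> c \<le> y \<and> y < d \<and> (x = a \<or> x = b)"
proof (cases "c \<le> y \<and> y < d \<and> a \<le> x \<and> x \<le> b")
  case True
  then have "plaquettes_containing ({a..b} \<times> {c..d}) (vedge x y)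
      = (if a < x then {(x - 1, y)} else {}) \<union> (if x < b then {(x, y)} else {})"
    by (auto simp: plaquettes_containing_vedge plaquettes_rectangle)
  then have "card (plaquettes_containing ({a..b} \<times> {c..d}) (vedge x y)) = of_bool (a < x) + of_bool (x < b)"
    by simp
  then show ?thesis using True assms by (auto simp: boundary_edges_def vedge_in_edges)
next
  case False
  then show ?thesis using assms by (auto simp: boundary_edges_def vedge_in_edges)
qed

text \<open>Equal row signs at the bottom and at the top mean that the boundary cycle has an even number
  of negative couplings. The gauges then fit together to a state \<open>\<tau>\<close> that satisfies the whole
  boundary, and so every state with the maximal number of satisfied boundary edges does the
  same.\<close>

lemma boundary_satisfied:
  fixes k :: int
  assumes k: "k \<ge> 1" and J: "\<And>e. e \<in> edges (strip k) \<Longrightarrow> J e \<noteq> 0"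
    and cd: "c < d" and eq: "row_sign J k c = row_sign J k d"
    and bc: "c_boundary_condition J ({- k..k} \<times> {c..d}) \<sigma>" (is "c_boundary_condition J ?R \<sigma>")
    and e: "e \<in> boundary_edges ({- k..k} \<times> {c..d})"
  shows "satisfied J \<sigma> e"
proof -
  define \<tau> :: state where "\<tau> = (\<lambda>(x, y).
    if y = c \<or> y = d then side_gauge J (- k) y * row_gauge J y (- k) * row_gauge J y x
    else if x = k then row_sign J k c * side_gauge J k y else side_gauge J (- k) y)"
  have pm: "side_gauge J x y = 1 \<or> side_gauge J x y = - 1" "row_gauge J y x = 1 \<or> row_gauge J y x = - 1" for x y
    unfolding side_gauge_def row_gauge_def by (rule running_sign_cases)+
  have \<tau>: "\<tau> v \<in> {- 1, 1}" for v
  proof (cases v)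
    case (Pair x y)
    show ?thesis
      using pm(1)[of "- k" y] pm(1)[of k y] pm(2)[of y "- k"] pm(2)[of y x] row_sign_cases[of J k c]
      unfolding Pair \<tau>_def by (elim disjE) simp_all
  qed
  have left: "\<tau> (- k, y) = side_gauge J (- k) y" for y
    using pm(2)[of y "- k"] k by (auto simp: \<tau>_def)
  have right: "\<tau> (k, y) = row_sign J k c * side_gauge J k y" for y
  proof (cases "y = c \<or> y = d")
    case True
    then have "row_sign J k c = row_sign J k y" using eq by auto
    then show ?thesis using True pm(1)[of k y] by (auto simp: \<tau>_def row_sign_def)
  qed (auto simp: \<tau>_def)
  have sat: "satisfied J \<tau> e" if "e \<in> boundary_edges ?R" for e
  proof -
    have "e \<in> edges ?R" using that by (simp add: boundary_edges_def)
    then show ?thesis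
    proof (cases rule: edges_cases)
      case (h x y)
      then have xy: "- k \<le> x" "x < k" "y = c \<or> y = d"
        using that hedge_boundary_rectangle[of "- k" k c d x y] k cd by auto
      have "J (hedge x y) \<noteq> 0" using xy by (intro J) (auto simp: hedge_in_edges in_strip)
      then have "satisfied J \<tau> (hedge x y) \<longleftrightarrow>
          \<tau> (x, y) * row_gauge J y x = \<tau> (x + 1, y) * row_gauge J y (x + 1)"
        by (rule satisfied_hedge_iff[OF _ \<tau> \<tau>])
      then show ?thesis unfolding h(1) using xy(3) pm(2)[of y x] pm(2)[of y "x + 1"]
        by (auto simp: \<tau>_def)
    next
      case (v x y)
      then have xy: "x = - k \<or> x = k"
        using that vedge_boundary_rectangle[of "- k" k c d x y] k cd by auto
      have "J (vedge x y) \<noteq> 0" using xy k by (intro J) (auto simp: vedge_in_edges in_strip)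
      then have "satisfied J \<tau> (vedge x y) \<longleftrightarrow>
          \<tau> (x, y) * side_gauge J x y = \<tau> (x, y + 1) * side_gauge J x (y + 1)"
        by (rule satisfied_vedge_iff[OF _ \<tau> \<tau>])
      then show ?thesis unfolding v(1) using xy pm(1)[of x y] pm(1)[of x "y + 1"] left right
        by auto
    qed
  qed
  have fin: "finite (boundary_edges ?R)"
    using finite_edges[of ?R] by (auto simp: boundary_edges_def)
  have all: "{e \<in> boundary_edges ?R. satisfied J \<tau> e} = boundary_edges ?R" using sat by blast
  have "is_state ?R \<tau>" using \<tau> by (simp add: is_state_def)
  then have "\<not> card {e \<in> boundary_edges ?R. satisfied J \<sigma> e}
      < card {e \<in> boundary_edges ?R. satisfied J \<tau> e}"
    using bc unfolding c_boundary_condition_def is_arg_max_def by blast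
  then have "card (boundary_edges ?R) \<le> card {e \<in> boundary_edges ?R. satisfied J \<sigma> e}"
    unfolding all by simp
  then have "{e \<in> boundary_edges ?R. satisfied J \<sigma> e} = boundary_edges ?R"
    by (intro card_seteq[OF fin]) auto
  then show ?thesis using e by blast
qed

text \<open>Transport of the spin from the left end of row \<open>y\<close> down the left side, across the bottom row,
  and up the right side. The bottom row enters only through its row sign, which will distinguish
  the two limits.\<close>

lemma ends_product:
  fixes k :: int
  assumes k: "k \<ge> 1" and J: "\<And>e. e \<in> edges (strip k) \<Longrightarrow> J e \<noteq> 0"
    and cd: "c < d" "c \<le> y" "y \<le> d"
    and \<sigma>: "is_state ({- k..k} \<times> {c..d}) \<sigma>"
    and sat: "\<And>e. e \<in> boundary_edges ({- k..k} \<times> {c..d}) \<Longrightarrow> satisfied J \<sigma> e"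
  shows "\<sigma> (- k, y) * \<sigma> (k, y) = row_sign J k c * side_gauge J (- k) y * side_gauge J k y"
proof -
  have pm: "side_gauge J x y = 1 \<or> side_gauge J x y = - 1" "row_gauge J y x = 1 \<or> row_gauge J y x = - 1" for x y
    unfolding side_gauge_def row_gauge_def by (rule running_sign_cases)+
  have st: "\<sigma> (x, y) \<in> {- 1, 1}" if "- k \<le> x" "x \<le> k" "c \<le> y" "y \<le> d" for x y
    using \<sigma> that by (auto simp: is_state_def)
  have vert: "\<sigma> (x, y) * side_gauge J x y = \<sigma> (x, c) * side_gauge J x c" if "x = - k \<or> x = k" for x
  proof (rule constant_on_interval[of c d])
    fix z assume z: "c \<le> z" "z < d"
    have "vedge x z \<in> boundary_edges ({- k..k} \<times> {c..d})"
      using vedge_boundary_rectangle[of "- k" k c d] that z k by auto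
    moreover have "J (vedge x z) \<noteq> 0" using that k by (intro J) (auto simp: vedge_in_edges in_strip)
    ultimately show "\<sigma> (x, z) * side_gauge J x z = \<sigma> (x, z + 1) * side_gauge J x (z + 1)"
      using sat satisfied_vedge_iff[of J x z \<sigma>] st[of x z] st[of x "z + 1"] that z k by auto
  qed (use cd in auto)
  have hor: "\<sigma> (k, c) * row_gauge J c k = \<sigma> (- k, c) * row_gauge J c (- k)"
  proof (rule constant_on_interval[of "- k" k "\<lambda>x. \<sigma> (x, c) * row_gauge J c x"])
    fix z assume z: "- k \<le> z" "z < k"
    have "hedge z c \<in> boundary_edges ({- k..k} \<times> {c..d})"
      using hedge_boundary_rectangle[of "- k" k c d] z k cd by auto
    moreover have "J (hedge z c) \<noteq> 0" using z by (intro J) (auto simp: hedge_in_edges in_strip)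
    ultimately show "\<sigma> (z, c) * row_gauge J c z = \<sigma> (z + 1, c) * row_gauge J c (z + 1)"
      using sat satisfied_hedge_iff[of J z c \<sigma>] st[of z c] st[of "z + 1" c] z cd by auto
  qed (use k in auto)
  have cancel: "a = b * r" if "a * r = b" "r = 1 \<or> r = - 1" for a b r :: real using that by auto
  have l: "\<sigma> (- k, y) = \<sigma> (- k, c) * side_gauge J (- k) c * side_gauge J (- k) y"
    using cancel[OF vert pm(1)] by simp
  have r: "\<sigma> (k, y) = \<sigma> (k, c) * side_gauge J k c * side_gauge J k y"
    using cancel[OF vert pm(1)] by simp
  have h: "\<sigma> (k, c) = \<sigma> (- k, c) * row_gauge J c (- k) * row_gauge J c k"
    by (rule cancel[OF hor pm(2)])
  have sq: "\<sigma> (- k, c) * \<sigma> (- k, c) = 1" using st[of "- k" c] k cd by auto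
  have "\<sigma> (- k, y) * \<sigma> (k, y) = (\<sigma> (- k, c) * \<sigma> (- k, c)) * (row_sign J k c * side_gauge J (- k) y * side_gauge J k y)"
    unfolding l r h row_sign_def by (simp only: ac_simps)
  then show ?thesis unfolding sq by simp
qed

section \<open>Uniqueness, compactness and incongruent limits\<close>

text \<open>No two disjoint finite sets of edges have equal total coupling, which excludes ties between
  the energies of finite systems; with one set empty and the other a singleton it also excludes
  vanishing couplings.\<close>

definition generic :: "int \<Rightarrow> (edge \<Rightarrow> real) \<Rightarrow> bool" where
  "generic k J \<longleftrightarrow> (\<forall>G H. finite G \<and> finite H \<and> G \<subseteq> edges (strip k) \<and> H \<subseteq> edges (strip k) \<and>
     G \<inter> H = {} \<and> G \<union> H \<noteq> {} \<longrightarrow> sum J G \<noteq> sum J H)"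

lemma generic_nonzero:
  assumes "generic k J" "e \<in> edges (strip k)"
  shows "J e \<noteq> 0"
  using assms(1)[unfolded generic_def, rule_format, of "{e}" "{}"] assms(2) by simp

lemma edges_mono: "V \<subseteq> W \<Longrightarrow> edges V \<subseteq> edges W"
  unfolding edges_def by blast

lemma spin_product_cases:
  assumes "is_state V \<sigma>" "e \<in> edges V"
  shows "spin_product \<sigma> e = 1 \<or> spin_product \<sigma> e = - 1"
  using assms(2)
proof (cases rule: edges_cases)
  case (h x y)
  then have "\<sigma> (x, y) \<in> {- 1, 1}" "\<sigma> (x + 1, y) \<in> {- 1, 1}" using assms(1) by (auto simp: is_state_def)
  then show ?thesis unfolding h(1) spin_product_hedge by auto
next
  case (v x y)
  then have "\<sigma> (x, y) \<in> {- 1, 1}" "\<sigma> (x, y + 1) \<in> {- 1, 1}" using assms(1) by (auto simp: is_state_def)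
  then show ?thesis unfolding v(1) spin_product_vedge by auto
qed

lemma c_groundstate_state: "c_groundstate J V \<sigma> \<Longrightarrow> is_state V \<sigma>"
  by (simp add: c_groundstate_def c_boundary_condition_def is_arg_min_def is_arg_max_def)

text \<open>The energies of two groundstates agree, and their difference is twice the difference of the
  coupling sums over the edges where only the first, respectively only the second, has aligned
  spins.\<close>

lemma c_groundstate_unique:
  assumes gen: "generic k J" and V: "finite V" "V \<subseteq> strip k"
    and \<sigma>: "c_groundstate J V \<sigma>" and \<tau>: "c_groundstate J V \<tau>" and e: "e \<in> edges V"
  shows "spin_product \<sigma> e = spin_product \<tau> e"
proof -
  let ?s = "spin_product \<sigma>" and ?t = "spin_product \<tau>"
  define G where "G = {e \<in> edges V. ?s e = 1 \<and> ?t e = - 1}"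
  define H where "H = {e \<in> edges V. ?s e = - 1 \<and> ?t e = 1}"
  have fin: "finite (edges V)" by (rule finite_edges[OF V(1)])
  have pm: "?s e = 1 \<or> ?s e = - 1" "?t e = 1 \<or> ?t e = - 1" if "e \<in> edges V" for e
    using spin_product_cases[OF c_groundstate_state that] \<sigma> \<tau> by auto
  have "\<not> energy J V \<sigma> < energy J V \<tau>" "\<not> energy J V \<tau> < energy J V \<sigma>"
    using \<sigma> \<tau> by (auto simp: c_groundstate_def is_arg_min_def)
  then have "(\<Sum>e\<in>edges V. J e * ?s e) = (\<Sum>e\<in>edges V. J e * ?t e)" by (simp add: energy_def)
  then have "0 = (\<Sum>e\<in>edges V. J e * (?s e - ?t e))"
    by (simp add: right_diff_distrib sum_subtractf)
  also have "\<dots> = (\<Sum>e\<in>edges V. 2 * (if e \<in> G then J e else 0) - 2 * (if e \<in> H then J e else 0))"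
  proof (rule sum.cong[OF refl])
    fix e assume "e \<in> edges V"
    then show "J e * (?s e - ?t e) = 2 * (if e \<in> G then J e else 0) - 2 * (if e \<in> H then J e else 0)"
      using pm[of e] by (auto simp: G_def H_def)
  qed
  also have "\<dots> = 2 * (\<Sum>e\<in>edges V. if e \<in> G then J e else 0) - 2 * (\<Sum>e\<in>edges V. if e \<in> H then J e else 0)"
    by (simp add: sum_subtractf sum_distrib_left)
  also have "\<dots> = 2 * sum J G - 2 * sum J H"
  proof -
    have "edges V \<inter> G = G" "edges V \<inter> H = H" by (auto simp: G_def H_def)
    then show ?thesis using fin by (simp add: sum.inter_restrict[symmetric])
  qed
  finally have "sum J G = sum J H" by simp
  moreover have "G \<subseteq> edges V" "H \<subseteq> edges V" by (auto simp: G_def H_def)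
  moreover from this have "finite G" "finite H" using fin finite_subset by blast+
  moreover have "G \<inter> H = {}" by (auto simp: G_def H_def)
  ultimately have "G \<union> H = {}"
    using gen edges_mono[OF V(2)] unfolding generic_def by (meson order_trans)
  then show ?thesis using pm[OF e] e by (auto simp: G_def H_def)
qed

lemma constant_on_rectangle:
  fixes g :: "vertex \<Rightarrow> 'c"
  assumes h: "\<And>x y. hedge x y \<in> edges ({a..b} \<times> {c..d}) \<Longrightarrow> g (x, y) = g (x + 1, y)"
    and v: "\<And>x y. vedge x y \<in> edges ({a..b} \<times> {c..d}) \<Longrightarrow> g (x, y) = g (x, y + 1)"
    and uw: "u \<in> {a..b} \<times> {c..d}" "w \<in> {a..b} \<times> {c..d}"
  shows "g u = g w"
proof -
  have "g (x, y) = g (a, c)" if "(x, y) \<in> {a..b} \<times> {c..d}" for x y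
  proof -
    have "g (x, y) = g (a, y)"
      by (rule constant_on_interval[of a b "\<lambda>x. g (x, y)"]) (use that in \<open>auto intro!: h simp: hedge_in_edges\<close>)
    also have "\<dots> = g (a, c)"
      by (rule constant_on_interval[of c d "\<lambda>y. g (a, y)"]) (use that in \<open>auto intro!: v simp: vedge_in_edges\<close>)
    finally show ?thesis .
  qed
  then show ?thesis using uw by (metis prod.exhaust)
qed

lemma c_groundstate_unique_normalized:
  assumes gen: "generic k J" and V: "V = {a..b} \<times> {c..d}" "V \<subseteq> strip k"
    and \<sigma>: "c_groundstate J V \<sigma>" and \<tau>: "c_groundstate J V \<tau>" and uw: "u \<in> V" "w \<in> V"
  shows "\<sigma> u * \<sigma> w = \<tau> u * \<tau> w"
proof -
  have "finite V" by (simp add: V(1))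
  note eq = c_groundstate_unique[OF gen this V(2) \<sigma> \<tau>]
  have st: "\<sigma> v = 1 \<or> \<sigma> v = - 1" "\<tau> v = 1 \<or> \<tau> v = - 1" if "v \<in> V" for v
    using c_groundstate_state[OF \<sigma>] c_groundstate_state[OF \<tau>] that by (auto simp: is_state_def)
  have pair: "p * q = p' * q'" if "p = 1 \<or> p = - 1" "q = 1 \<or> q = - 1" "p' = 1 \<or> p' = - 1"
    "q' = 1 \<or> q' = - 1" "p * p' = q * q'" for p q p' q' :: real
    using that by auto
  have "\<sigma> u * \<tau> u = \<sigma> w * \<tau> w"
  proof (rule constant_on_rectangle[of a b c d "\<lambda>v. \<sigma> v * \<tau> v"])
    fix x y
    assume e: "hedge x y \<in> edges ({a..b} \<times> {c..d})"
    then have V: "(x, y) \<in> V" "(x + 1, y) \<in> V" by (auto simp: V(1) hedge_in_edges)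
    show "\<sigma> (x, y) * \<tau> (x, y) = \<sigma> (x + 1, y) * \<tau> (x + 1, y)"
      using eq[OF e[folded \<open>V = {a..b} \<times> {c..d}\<close>]] unfolding spin_product_hedge
      by (rule pair[OF st(1)[OF V(1)] st(2)[OF V(1)] st(1)[OF V(2)] st(2)[OF V(2)]])
  next
    fix x y
    assume e: "vedge x y \<in> edges ({a..b} \<times> {c..d})"
    then have V: "(x, y) \<in> V" "(x, y + 1) \<in> V" by (auto simp: V(1) vedge_in_edges)
    show "\<sigma> (x, y) * \<tau> (x, y) = \<sigma> (x, y + 1) * \<tau> (x, y + 1)"
      using eq[OF e[folded \<open>V = {a..b} \<times> {c..d}\<close>]] unfolding spin_product_vedge
      by (rule pair[OF st(1)[OF V(1)] st(2)[OF V(1)] st(1)[OF V(2)] st(2)[OF V(2)]])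
  qed (use uw V(1) in auto)
  then show ?thesis
    by (rule pair[OF st(1)[OF uw(1)] st(1)[OF uw(2)] st(2)[OF uw(1)] st(2)[OF uw(2)]])
qed

text \<open>Sequential compactness of a countable product of two-point spaces, by a diagonal
  sequence.\<close>

lemma convergent_subsequence:
  fixes f :: "nat \<Rightarrow> 'c :: countable \<Rightarrow> bool"
  obtains r :: "nat \<Rightarrow> nat" and l :: "'c \<Rightarrow> bool"
  where "strict_mono r" "\<And>z. eventually (\<lambda>n. f (r n) z = l z) sequentially"
proof -
  define P where "P n s \<longleftrightarrow> (\<exists>b. \<forall>\<^sub>F i in sequentially. f (s i) (from_nat n) = b)" for n and s :: "nat \<Rightarrow> nat"
  interpret subseqs P
  proof
    fix n and s :: "nat \<Rightarrow> nat" assume "strict_mono s"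
    let ?S = "\<lambda>b. {i. f (s i) (from_nat n) = b}"
    have "?S True \<union> ?S False = UNIV" by auto
    then have "infinite (?S True) \<or> infinite (?S False)" by (metis finite_UnI infinite_UNIV_nat)
    then obtain b where b: "infinite (?S b)" by blast
    then obtain r :: "nat \<Rightarrow> nat" where "strict_mono r" "\<And>i. r i \<in> ?S b"
      using infinite_enumerate[OF b] by blast
    then have "strict_mono r \<and> P n (s \<circ> r)" unfolding P_def by (auto intro!: exI[of _ b])
    then show "\<exists>r'. strict_mono r' \<and> P n (s \<circ> r')" by blast
  qed
  have shift: "\<exists>b. \<forall>\<^sub>F i in sequentially. f (diagseq i) z = b" for z
  proof -
    have "P (to_nat z) (diagseq \<circ> ((+) (Suc (to_nat z))))"
    proof (rule diagseq_holds)
      fix r s n assume "strict_mono (r :: nat \<Rightarrow> nat)" "P n s"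
      then obtain b where "\<forall>\<^sub>F i in sequentially. f (s i) (from_nat n) = b" by (auto simp: P_def)
      then have "\<forall>\<^sub>F i in sequentially. f (s (r i)) (from_nat n) = b"
        using filterlim_subseq[OF \<open>strict_mono r\<close>] by (rule eventually_compose_filterlim)
      then show "P n (s \<circ> r)" by (auto simp: P_def)
    qed
    then obtain b where "\<forall>\<^sub>F i in sequentially. f (diagseq (i + Suc (to_nat z))) z = b"
      by (auto simp: P_def add.commute)
    then show ?thesis by (subst (asm) eventually_sequentially_seg) blast
  qed
  then obtain l where "\<And>z. \<forall>\<^sub>F i in sequentially. f (diagseq i) z = l z" by metis
  with subseq_diagseq show thesis by (rule that)
qed

text \<open>Each edge of a side of the strip eventually lies on the boundary of the rectangles and is
  satisfied there, hence in the limit. Similarly the relation of the two ends of row zero, which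
  depends only on the common row sign \<open>\<epsilon>\<close> of all bottom and top rows, passes to the limit.\<close>

lemma limit_of_groundstates:
  fixes k :: int and lo hi :: "nat \<Rightarrow> int" and g :: "nat \<Rightarrow> nat" and l :: "vertex \<Rightarrow> bool"
  assumes k: "k \<ge> 1" and gen: "generic k J"
    and lo: "\<And>n. lo n < - int n" "\<And>n. row_sign J k (lo n) = \<epsilon>"
    and hi: "\<And>n. int n < hi n" "\<And>n. row_sign J k (hi n) = \<epsilon>"
    and g: "filterlim g at_top sequentially"
    and gs: "\<forall>\<^sub>F j in sequentially. c_groundstate J ({- k..k} \<times> {lo (g j)..hi (g j)}) (s j)"
    and conv: "\<forall>v\<in>strip k. \<forall>\<^sub>F j in sequentially. (s j v * s j (0, 0) = 1) = l v"
    and \<tau>: "\<tau> = (\<lambda>v. if l v then 1 else - 1)"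
  shows "converges_to k s \<tau>"
    and "x \<in> {- k, k} \<Longrightarrow> satisfied J \<tau> (vedge x y)"
    and "\<tau> (- k, 0) * \<tau> (k, 0) = \<epsilon> * side_gauge J (- k) 0 * side_gauge J k 0"
proof -
  define Q where "Q j = {- k..k} \<times> {lo (g j)..hi (g j)}" for j
  have gs: "\<forall>\<^sub>F j in sequentially. c_groundstate J (Q j) (s j)" using gs unfolding Q_def .
  have J: "J e \<noteq> 0" if "e \<in> edges (strip k)" for e using generic_nonzero[OF gen that] .
  have inQ: "\<forall>\<^sub>F j in sequentially. v \<in> Q j" if "v \<in> strip k" for v
  proof -
    have "\<forall>\<^sub>F j in sequentially. g j \<ge> nat \<bar>snd v\<bar>" using g by (simp add: filterlim_at_top)
    then show ?thesis
    proof eventually_elim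
      case (elim j)
      then have "lo (g j) \<le> snd v" "snd v \<le> hi (g j)" using lo(1)[of "g j"] hi(1)[of "g j"] by linarith+
      then show ?case using that by (cases v) (auto simp: Q_def in_strip)
    qed
  qed
  have val: "\<forall>\<^sub>F j in sequentially. s j v * s j (0, 0) = \<tau> v \<and> s j (0, 0) * s j (0, 0) = 1"
    if "v \<in> strip k" for v
  proof -
    have "(0, 0) \<in> strip k" using k by (simp add: in_strip)
    from gs inQ[OF that] inQ[OF this] conv[rule_format, OF that] show ?thesis
    proof eventually_elim
      case (elim j)
      then have "s j v \<in> {- 1, 1}" "s j (0, 0) \<in> {- 1, 1}"
        using c_groundstate_state[OF elim(1)] by (auto simp: is_state_def)
      then show ?case using elim(4) by (auto simp: \<tau>)
    qed
  qed
  have pair: "\<forall>\<^sub>F j in sequentially. s j u * s j w = \<tau> u * \<tau> w" if "u \<in> strip k" "w \<in> strip k" for u w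
    using val[OF that(1)] val[OF that(2)]
  proof eventually_elim
    case (elim j)
    have "\<tau> u * \<tau> w = (s j u * s j w) * (s j (0, 0) * s j (0, 0))"
      unfolding elim[THEN conjunct1, symmetric] by (simp only: ac_simps)
    then show ?case using elim by simp
  qed
  have prod: "\<forall>\<^sub>F j in sequentially. spin_product (s j) e = spin_product \<tau> e" if "e \<in> edges (strip k)" for e
    using that
  proof (cases rule: edges_cases)
    case (h x y)
    then show ?thesis using pair[OF h(2,3)] by (simp add: spin_product_hedge)
  next
    case (v x y)
    then show ?thesis using pair[OF v(2,3)] by (simp add: spin_product_vedge)
  qed
  show "converges_to k s \<tau>" using prod unfolding converges_to_def is_state_def by (simp add: \<tau>)
  have boundary: "satisfied J (s j) e" if "c_groundstate J (Q j) (s j)" "e \<in> boundary_edges (Q j)" for j e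
  proof (rule boundary_satisfied[OF k J])
    show "lo (g j) < hi (g j)" using lo(1)[of "g j"] hi(1)[of "g j"] by linarith
    show "row_sign J k (lo (g j)) = row_sign J k (hi (g j))" using lo(2) hi(2) by simp
    show "c_boundary_condition J ({- k..k} \<times> {lo (g j)..hi (g j)}) (s j)"
      using that(1) by (simp add: c_groundstate_def is_arg_min_def Q_def)
  qed (use that in \<open>simp_all add: Q_def\<close>)
  show "satisfied J \<tau> (vedge x y)" if x: "x \<in> {- k, k}"
  proof -
    have v: "(x, y) \<in> strip k" "(x, y + 1) \<in> strip k" using x k by (auto simp: in_strip)
    then have "vedge x y \<in> edges (strip k)" by (simp add: vedge_in_edges)
    from gs inQ[OF v(1)] inQ[OF v(2)] prod[OF this]
    have "\<forall>\<^sub>F j in sequentially. satisfied J \<tau> (vedge x y)"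
    proof eventually_elim
      case (elim j)
      have "vedge x y \<in> boundary_edges (Q j)"
        unfolding Q_def using elim(2,3) x k by (subst vedge_boundary_rectangle) (auto simp: Q_def)
      then have "satisfied J (s j) (vedge x y)" by (rule boundary[OF elim(1)])
      then show ?case using elim(4) by (simp add: satisfied_def)
    qed
    then show ?thesis by simp
  qed
  have ks: "(- k, 0) \<in> strip k" "(k, 0) \<in> strip k" using k by (auto simp: in_strip)
  from gs pair[OF ks] have "\<forall>\<^sub>F j in sequentially. \<tau> (- k, 0) * \<tau> (k, 0) = \<epsilon> * side_gauge J (- k) 0 * side_gauge J k 0"
  proof eventually_elim
    case (elim j)
    have "s j (- k, 0) * s j (k, 0) = row_sign J k (lo (g j)) * side_gauge J (- k) 0 * side_gauge J k 0"
    proof (rule ends_product[OF k J])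
      show "lo (g j) < hi (g j)" "lo (g j) \<le> 0" "0 \<le> hi (g j)"
        using lo(1)[of "g j"] hi(1)[of "g j"] by linarith+
    qed (use boundary[OF elim(1)] c_groundstate_state[OF elim(1)] in \<open>simp_all add: Q_def\<close>)
    then show ?case using elim(2) lo(2) by simp
  qed
  then show "\<tau> (- k, 0) * \<tau> (k, 0) = \<epsilon> * side_gauge J (- k) 0 * side_gauge J k 0" by simp
qed

text \<open>Rectangles bounded by rows of sign \<open>1\<close> and of sign \<open>- 1\<close> both exhaust the strip. A common
  subsequence makes the groundstates of both families converge, and choosing rectangles from the two
  families in turn, each large enough to contain the previous one, nests them. The two limits satisfy
  the sides but relate them by opposite signs.\<close>

lemma incongruent_limits:
  fixes k :: int
  assumes k: "k \<ge> 1" and gen: "generic k J"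
    and up: "\<And>\<epsilon> b. \<epsilon> = 1 \<or> \<epsilon> = - 1 \<Longrightarrow> \<exists>y > b. row_sign J k y = \<epsilon>"
    and down: "\<And>\<epsilon> b. \<epsilon> = 1 \<or> \<epsilon> = - 1 \<Longrightarrow> \<exists>y < b. row_sign J k y = \<epsilon>"
  shows "\<exists>S. exhausting_sublattices k S \<and>
    (\<forall>es os.
      (\<forall>j\<ge>1. c_groundstate J (S (2 * j)) (es j)) \<and>
      (\<forall>j\<ge>1. c_groundstate J (S (2 * j - 1)) (os j)) \<longrightarrow>
      (\<exists>even_limit odd_limit.
        converges_to k es even_limit \<and> converges_to k os odd_limit \<and>
        finitely_incongruent J k even_limit odd_limit))"
proof -
  define sg :: "bool \<Rightarrow> real" where "sg b = (if b then 1 else - 1)" for b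
  have sg: "sg b = 1 \<or> sg b = - 1" for b by (simp add: sg_def)
  have "\<forall>b n. \<exists>y < - int n. row_sign J k y = sg b" using down[OF sg] by blast
  then obtain lo where lo: "\<And>b n. lo b n < - int n" "\<And>b n. row_sign J k (lo b n) = sg b" by metis
  have "\<forall>b n. \<exists>y > int n. row_sign J k y = sg b" using up[OF sg] by blast
  then obtain hi where hi: "\<And>b n. int n < hi b n" "\<And>b n. row_sign J k (hi b n) = sg b" by metis
  define R where "R b n = {- k..k} \<times> {lo b n..hi b n}" for b n
  have Rstrip: "R b n \<subseteq> strip k" for b n by (auto simp: R_def in_strip)
  have Rin: "v \<in> R b n" if "v \<in> strip k" "nat \<bar>snd v\<bar> \<le> n" for v b n
  proof -
    have "lo b n \<le> snd v" "snd v \<le> hi b n" using that lo(1)[of b n] hi(1)[of n b] by linarith+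
    then show ?thesis using that by (cases v) (auto simp: R_def in_strip)
  qed
  \<comment> \<open>By uniqueness this tells the spin at \<open>v\<close> relative to the origin in any groundstate.\<close>
  define f where "f n = (\<lambda>(b, v). \<exists>\<sigma>. c_groundstate J (R b n) \<sigma> \<and> \<sigma> v * \<sigma> (0, 0) = 1)" for n
  obtain r l where r: "strict_mono r" and l: "\<And>z. \<forall>\<^sub>F n in sequentially. f (r n) z = l z"
    using convergent_subsequence[of f] by blast
  define h where "h n = nat (\<bar>lo True n\<bar> + \<bar>lo False n\<bar> + \<bar>hi True n\<bar> + \<bar>hi False n\<bar>)" for n
  have h: "R b n \<subseteq> R b' m" if "h n \<le> m" for b b' n m
  proof
    fix v assume v: "v \<in> R b n"
    have "\<bar>lo b n\<bar> \<le> int (h n)" unfolding h_def by (cases b) auto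
    moreover have "\<bar>hi b n\<bar> \<le> int (h n)" unfolding h_def by (cases b) auto
    moreover have "lo b n \<le> snd v" "snd v \<le> hi b n" using v by (auto simp: R_def)
    ultimately have "nat \<bar>snd v\<bar> \<le> m" using that by linarith
    then show "v \<in> R b' m" using v Rstrip by (intro Rin) auto
  qed
  define i where "i = rec_nat 0 (\<lambda>_ x. max (Suc x) (h (r x)))"
  have i_Suc: "i (Suc n) = max (Suc (i n)) (h (r (i n)))" for n by (simp add: i_def)
  have i: "strict_mono i" by (simp add: strict_mono_Suc_iff i_Suc less_max_iff_disj)
  have ri: "n \<le> r (i n)" for n using seq_suble[OF r, of "i n"] seq_suble[OF i, of n] by linarith
  define S where "S n = R (even n) (r (i n))" for n
  have "S n \<subseteq> S (n + 1)" for n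
  proof -
    have "h (r (i n)) \<le> r (i (n + 1))"
      using seq_suble[OF r, of "i (n + 1)"] i_Suc[of n] by simp
    then show ?thesis unfolding S_def by (rule h)
  qed
  moreover have "finite_sublattice k (S n)" for n
  proof -
    have "lo (even n) (r (i n)) < hi (even n) (r (i n))"
      using lo(1)[of "even n" "r (i n)"] hi(1)[of "r (i n)" "even n"] by linarith
    then show ?thesis using k Rstrip unfolding finite_sublattice_def S_def R_def
      by (intro exI[of _ "- k"] exI[of _ k] exI[of _ "lo (even n) (r (i n))"] exI[of _ "hi (even n) (r (i n))"])
        auto
  qed
  moreover have "(\<Union>n\<in>{1..}. S n) = strip k"
  proof
    show "(\<Union>n\<in>{1..}. S n) \<subseteq> strip k" using Rstrip by (auto simp: S_def)
    show "strip k \<subseteq> (\<Union>n\<in>{1..}. S n)"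
    proof
      fix v assume v: "v \<in> strip k"
      have "v \<in> S (Suc (nat \<bar>snd v\<bar>))" unfolding S_def
        using ri[of "Suc (nat \<bar>snd v\<bar>)"] by (intro Rin[OF v]) simp
      then show "v \<in> (\<Union>n\<in>{1..}. S n)" by (intro UN_I[of "Suc (nat \<bar>snd v\<bar>)"]) auto
    qed
  qed
  ultimately have S: "exhausting_sublattices k S" by (simp add: exhausting_sublattices_def)
  define lim :: "bool \<Rightarrow> state" where "lim b = (\<lambda>v. if l (b, v) then 1 else - 1)" for b
  have limit: "converges_to k s (lim b) \<and> (\<forall>x y. x \<in> {- k, k} \<longrightarrow> satisfied J (lim b) (vedge x y)) \<and>
      lim b (- k, 0) * lim b (k, 0) = sg b * side_gauge J (- k) 0 * side_gauge J k 0"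
    if p: "filterlim p at_top sequentially" and gs: "\<forall>\<^sub>F j in sequentially. c_groundstate J (R b (r (i (p j)))) (s j)"
    for b p s
  proof -
    let ?g = "\<lambda>j. r (i (p j))"
    have ip: "filterlim (\<lambda>j. i (p j)) at_top sequentially"
      by (rule filterlim_compose[OF filterlim_subseq[OF i] p])
    have g: "filterlim ?g at_top sequentially"
      by (rule filterlim_compose[OF filterlim_subseq[OF r] ip])
    have conv: "\<forall>v\<in>strip k. \<forall>\<^sub>F j in sequentially. (s j v * s j (0, 0) = 1) = l (b, v)"
    proof
      fix v assume v: "v \<in> strip k"
      have "\<forall>\<^sub>F j in sequentially. ?g j \<ge> nat \<bar>snd v\<bar>" using g by (simp add: filterlim_at_top)
      with eventually_compose_filterlim[OF l[of "(b, v)"] ip] gs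
      show "\<forall>\<^sub>F j in sequentially. (s j v * s j (0, 0) = 1) = l (b, v)"
      proof eventually_elim
        case (elim j)
        have "v \<in> R b (?g j)" using v elim(3) by (rule Rin)
        moreover have "(0, 0) \<in> R b (?g j)" using k by (intro Rin) (auto simp: in_strip)
        ultimately have uniq: "\<sigma> v * \<sigma> (0, 0) = s j v * s j (0, 0)" if "c_groundstate J (R b (?g j)) \<sigma>" for \<sigma>
          using c_groundstate_unique_normalized[OF gen R_def Rstrip that elim(2)] by blast
        have "f (?g j) (b, v) \<longleftrightarrow> (\<exists>\<sigma>. c_groundstate J (R b (?g j)) \<sigma> \<and> \<sigma> v * \<sigma> (0, 0) = 1)"
          by (simp add: f_def)
        also have "\<dots> \<longleftrightarrow> s j v * s j (0, 0) = 1" using uniq elim(2) by metis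
        finally show ?case using elim(1) by simp
      qed
    qed
    note L = limit_of_groundstates[OF k gen lo hi g gs[unfolded R_def] conv lim_def]
    show ?thesis using L(2) by (intro conjI allI impI L(1) L(3)) blast
  qed
  show ?thesis
  proof (intro exI[of _ S] conjI S allI impI)
    fix es os :: "nat \<Rightarrow> state"
    assume gs: "(\<forall>j\<ge>1. c_groundstate J (S (2 * j)) (es j)) \<and> (\<forall>j\<ge>1. c_groundstate J (S (2 * j - 1)) (os j))"
    have even: "\<forall>\<^sub>F j in sequentially. c_groundstate J (R True (r (i (2 * j)))) (es j)"
      using gs by (auto simp: S_def eventually_sequentially intro!: exI[of _ 1])
    have odd: "\<forall>\<^sub>F j in sequentially. c_groundstate J (R False (r (i (2 * j - 1)))) (os j)"
      unfolding eventually_sequentially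
    proof (intro exI[of _ 1] allI impI)
      fix j :: nat assume "1 \<le> j"
      moreover from this have "odd (2 * j - 1)" by simp
      ultimately show "c_groundstate J (R False (r (i (2 * j - 1)))) (os j)"
        using gs by (auto simp: S_def)
    qed
    have "filterlim (\<lambda>j :: nat. 2 * j) at_top sequentially" "filterlim (\<lambda>j :: nat. 2 * j - 1) at_top sequentially"
      by (rule filterlim_at_top_mono[OF filterlim_ident], rule always_eventually, intro allI, linarith)+
    note E = limit[OF this(1) even] and O = limit[OF this(2) odd]
    have "finitely_incongruent J k (lim True) (lim False)"
    proof (rule finitely_incongruentI[OF k])
      show "J e \<noteq> 0" if "e \<in> edges (strip k)" for e using generic_nonzero[OF gen that] .
      show "is_state (strip k) (lim True)" "is_state (strip k) (lim False)"
        using E O by (auto simp: converges_to_def)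
      show "satisfied J (lim True) (vedge x y) \<and> satisfied J (lim False) (vedge x y)"
        if "x \<in> {- k, k}" for x y using E O that by blast
      have "side_gauge J (- k) 0 \<noteq> 0" "side_gauge J k 0 \<noteq> 0"
        using running_sign_square unfolding side_gauge_def by (metis mult_zero_left zero_neq_one)+
      then show "lim True (- k, 0) * lim True (k, 0) \<noteq> lim False (- k, 0) * lim False (k, 0)"
        using E O by (simp add: sg_def)
    qed
    then show "\<exists>even_limit odd_limit. converges_to k es even_limit \<and> converges_to k os odd_limit \<and>
        finitely_incongruent J k even_limit odd_limit"
      using E O by blast
  qed
qed

section \<open>Gaussian couplings\<close>

text \<open>A case of the second Borel-Cantelli lemma. The zero-one law leaves only two possibilities,
  and the limit superior has probability at least \<open>c\<close>.\<close>

lemma (in prob_space) AE_infinitely_often: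
  fixes B :: "nat \<Rightarrow> 'a set"
  assumes ind: "indep_events B UNIV" and c: "c > 0" "\<And>n. c \<le> prob (B n)"
  shows "AE \<omega> in M. infinite {n. \<omega> \<in> B n}"
proof -
  have B: "B n \<in> events" for n using ind by (auto simp: indep_events_def)
  have "{\<omega> \<in> space M. \<omega> \<in> B n} = B n" for n using sets.sets_into_space[OF B[of n]] by auto
  then have "(AE \<omega> in M. infinite {n. \<omega> \<in> B n}) \<or> (AE \<omega> in M. finite {n. \<omega> \<in> B n})"
    using borel_0_1_law_AE[of "\<lambda>n \<omega>. \<omega> \<in> B n"] ind by simp
  moreover have "\<not> (AE \<omega> in M. finite {n. \<omega> \<in> B n})"
  proof
    assume fin: "AE \<omega> in M. finite {n. \<omega> \<in> B n}"
    define U where "U n = (\<Union>m\<in>{n..}. B m)" for n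
    have U: "U n \<in> events" for n unfolding U_def using B by auto
    have "decseq U" unfolding decseq_def U_def by (intro allI impI UN_mono) auto
    then have lim: "(\<lambda>n. prob (U n)) \<longlonglongrightarrow> prob (\<Inter>n. U n)"
      using U by (intro finite_Lim_measure_decseq) auto
    have "c \<le> prob (U n)" for n
      using c(2)[of n] finite_measure_mono[of "B n" "U n"] U by (auto simp: U_def intro: order_trans)
    then have "c \<le> prob (\<Inter>n. U n)" by (intro LIMSEQ_le_const[OF lim]) auto
    moreover have "AE \<omega> in M. \<omega> \<notin> (\<Inter>n. U n)"
      using fin
    proof eventually_elim
      case (elim \<omega>)
      then obtain b where "\<forall>n\<in>{n. \<omega> \<in> B n}. n < b" by (auto simp: finite_nat_set_iff_bounded)
      then have "\<omega> \<notin> U b" by (auto simp: U_def)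
      then show ?case by blast
    qed
    then have "prob (\<Inter>n. U n) = 0" using U by (subst prob_eq_0) auto
    ultimately show False using c(1) by simp
  qed
  ultimately show ?thesis by blast
qed

lemma (in prob_space) indep_events_blocks:
  fixes A :: "'i \<Rightarrow> 'a set" and G :: "nat \<Rightarrow> 'i set"
  assumes ind: "indep_events A I" and G: "\<And>n. finite (G n)" "\<And>n. G n \<noteq> {}" "\<And>n. G n \<subseteq> I"
    and disj: "disjoint_family G"
  shows "indep_events (\<lambda>n. \<Inter>e\<in>G n. A e) UNIV"
    and "prob (\<Inter>e\<in>G n. A e) = (\<Prod>e\<in>G n. prob (A e))"
proof -
  have A: "A e \<in> events" if "e \<in> I" for e using ind that by (auto simp: indep_events_def)
  have prod: "prob (\<Inter>e\<in>H. A e) = (\<Prod>e\<in>H. prob (A e))" if "finite H" "H \<noteq> {}" "H \<subseteq> I" for H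
    using ind that unfolding indep_events_def by blast
  show single: "prob (\<Inter>e\<in>G n. A e) = (\<Prod>e\<in>G n. prob (A e))" for n by (rule prod[OF G])
  show "indep_events (\<lambda>n. \<Inter>e\<in>G n. A e) UNIV"
  proof (rule indep_eventsI)
    show "(\<Inter>e\<in>G n. A e) \<in> events" for n
      using G(3)[of n] A by (intro sets.finite_INT[OF G(1) G(2)]) auto
    fix T :: "nat set" assume T: "finite T" "T \<noteq> {}"
    have "(\<Inter>n\<in>T. \<Inter>e\<in>G n. A e) = (\<Inter>e\<in>(\<Union>n\<in>T. G n). A e)" by auto
    also have "prob \<dots> = (\<Prod>e\<in>(\<Union>n\<in>T. G n). prob (A e))"
      using T G by (intro prod) auto
    also have "\<dots> = (\<Prod>n\<in>T. \<Prod>e\<in>G n. prob (A e))"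
      using T(1) G(1) disj by (intro prod.UNION_disjoint) (auto simp: disjoint_family_on_def)
    also have "\<dots> = (\<Prod>n\<in>T. prob (\<Inter>e\<in>G n. A e))" by (simp add: single)
    finally show "prob (\<Inter>n\<in>T. \<Inter>e\<in>G n. A e) = (\<Prod>n\<in>T. prob (\<Inter>e\<in>G n. A e))" .
  qed
qed

text \<open>The difference of the two sums is a sum of independent normal variables, up to signs, hence
  normal itself and without atoms.\<close>

lemma (in prob_space) AE_sums_distinct:
  fixes J :: "'i \<Rightarrow> 'a \<Rightarrow> real"
  assumes s: "s > 0" and ind: "indep_vars (\<lambda>_. borel) J I"
    and J: "\<And>e. e \<in> I \<Longrightarrow> distributed M lborel (J e) (normal_density 0 s)"
    and G: "finite G" "G \<subseteq> I" and H: "finite H" "H \<subseteq> I" and GH: "G \<inter> H = {}" "G \<union> H \<noteq> {}"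
  shows "AE \<omega> in M. (\<Sum>e\<in>G. J e \<omega>) \<noteq> (\<Sum>e\<in>H. J e \<omega>)"
proof -
  define a :: "'i \<Rightarrow> real" where "a e = (if e \<in> G then 1 else - 1)" for e
  let ?K = "G \<union> H"
  have "indep_vars (\<lambda>_. borel) J ?K" by (rule indep_vars_subset[OF ind]) (use G H in auto)
  then have "indep_vars (\<lambda>_. borel) (\<lambda>e \<omega>. a e * J e \<omega>) ?K"
    by (rule indep_vars_compose2[where Y = "\<lambda>e x. a e * x"]) auto
  moreover have "distributed M lborel (\<lambda>\<omega>. a e * J e \<omega>) (normal_density 0 s)" if "e \<in> ?K" for e
    using normal_density_affine[OF J s, of e "a e" 0] that G H by (auto simp: a_def split: if_splits)
  ultimately have D: "distributed M lborel (\<lambda>\<omega>. \<Sum>e\<in>?K. a e * J e \<omega>)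
      (normal_density (\<Sum>e\<in>?K. 0) (sqrt (\<Sum>e\<in>?K. s\<^sup>2)))"
    using G H GH s by (intro sum_indep_normal) auto
  have "AE x in lborel. (x :: real) \<noteq> 0" by (rule AE_lborel_singleton)
  then have "AE \<omega> in M. (\<Sum>e\<in>?K. a e * J e \<omega>) \<noteq> 0"
    by (subst distributed_AE2[OF D]) auto
  then show ?thesis
  proof eventually_elim
    case (elim \<omega>)
    have "(\<Sum>e\<in>?K. a e * J e \<omega>) = (\<Sum>e\<in>G. a e * J e \<omega>) + (\<Sum>e\<in>H. a e * J e \<omega>)"
      using G H GH by (intro sum.union_disjoint) auto
    also have "(\<Sum>e\<in>G. a e * J e \<omega>) = (\<Sum>e\<in>G. J e \<omega>)" by (simp add: a_def)
    also have "(\<Sum>e\<in>H. a e * J e \<omega>) = (\<Sum>e\<in>H. - J e \<omega>)"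
      using GH by (intro sum.cong) (auto simp: a_def)
    finally show ?case using elim by (simp add: sum_negf)
  qed
qed

lemma normal_half_lines_pos:
  assumes s: "s > 0"
  shows "measure (density lborel (normal_density 0 s)) {0<..} > 0"
    and "measure (density lborel (normal_density 0 s)) {..<0} > 0"
proof -
  let ?N = "density lborel (normal_density 0 s)"
  interpret N: prob_space ?N by (rule prob_space_normal_density[OF s])
  have pos: "measure ?N A > 0" if "A \<in> sets borel" "emeasure lborel A \<noteq> 0" for A
  proof (rule ccontr)
    assume "\<not> ?thesis"
    then have "measure ?N A = 0" using measure_nonneg[of ?N A] by linarith
    then have "AE x in ?N. x \<notin> A" using that(1) by (subst (asm) N.prob_eq_0) auto
    then have "AE x in lborel. x \<notin> A"
      using s by (subst (asm) AE_density) (auto simp: normal_density_pos)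
    then show False using that AE_iff_measurable[of A lborel "\<lambda>x. x \<notin> A"] by auto
  qed
  have "emeasure lborel {0<..<1 :: real} \<le> emeasure lborel {0 :: real<..}"
    "emeasure lborel {- 1<..<0 :: real} \<le> emeasure lborel {..<0 :: real}"
    by (intro emeasure_mono; auto)+
  then show "measure ?N {0<..} > 0" "measure ?N {..<0} > 0"
    by (auto intro!: pos)
qed

text \<open>All edges of rows \<open>y\<close> and \<open>y + 1\<close> and the two side edges between them. They form the cycle
  whose sign is the product of the row signs of \<open>y\<close> and \<open>y + 1\<close>.\<close>

definition ladder :: "int \<Rightarrow> int \<Rightarrow> edge set" where
  "ladder k y = {vedge (- k) y, vedge k y} \<union> (\<lambda>x. hedge x y) ` {- k..<k} \<union> (\<lambda>x. hedge x (y + 1)) ` {- k..<k}"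

lemma row_sign_flip:
  assumes k: "k \<ge> 1" and neg: "J (vedge (- k) y) < 0"
    and pos: "\<And>e. e \<in> ladder k y \<Longrightarrow> e \<noteq> vedge (- k) y \<Longrightarrow> J e > 0"
  shows "row_sign J k (y + 1) = - row_sign J k y"
proof -
  have row: "row_gauge J z k = row_gauge J z (- k)" if "z = y \<or> z = y + 1" for z
  proof (rule constant_on_interval[of "- k" k])
    fix x assume "- k \<le> x" "x < k"
    then have "J (hedge x z) > 0" using that by (intro pos) (auto simp: ladder_def)
    then show "row_gauge J z x = row_gauge J z (x + 1)" by (simp add: row_gauge_def running_sign_step coupling_sign_def)
  qed (use k in auto)
  have rr: "row_gauge J z x * row_gauge J z x = 1" for x z unfolding row_gauge_def by (rule running_sign_square)
  have rs: "row_sign J k z = side_gauge J (- k) z * side_gauge J k z" if "z = y \<or> z = y + 1" for z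
    unfolding row_sign_def row[OF that] using rr[of z "- k"] by (simp add: mult.assoc)
  have "side_gauge J (- k) (y + 1) = - side_gauge J (- k) y" using neg by (simp add: side_gauge_def running_sign_step coupling_sign_def)
  moreover have "J (vedge k y) > 0" using k by (intro pos) (auto simp: ladder_def)
  then have "side_gauge J k (y + 1) = side_gauge J k y" by (simp add: side_gauge_def running_sign_step coupling_sign_def)
  ultimately show ?thesis by (simp add: rs)
qed

lemma ladder_subset: "k \<ge> 1 \<Longrightarrow> ladder k y \<subseteq> edges (strip k)"
  by (auto simp: ladder_def hedge_in_edges vedge_in_edges in_strip)

text \<open>The ladders at even heights are disjoint, so prescribing the sign of every coupling of a ladder
  gives independent events for different ladders. A single negative coupling per ladder, on its left
  side edge, makes the row sign flip.\<close>

lemma (in prob_space) AE_flips: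
  fixes k :: int and J :: "edge \<Rightarrow> 'a \<Rightarrow> real" and z :: "nat \<Rightarrow> int"
  assumes k: "k \<ge> 1" and s: "s > 0" and ind: "indep_vars (\<lambda>_. borel) J (edges (strip k))"
    and J: "\<And>e. e \<in> edges (strip k) \<Longrightarrow> distributed M lborel (J e) (normal_density 0 s)"
    and z: "inj z"
  shows "AE \<omega> in M. infinite {n. row_sign (\<lambda>e. J e \<omega>) k (2 * z n + 1) = - row_sign (\<lambda>e. J e \<omega>) k (2 * z n)}"
proof -
  let ?N = "density lborel (normal_density 0 s)"
  define half :: "edge \<Rightarrow> real set" where "half e = (if e \<in> range (vedge (- k)) then {..<0} else {0<..})" for e
  define A where "A e = {\<omega> \<in> space M. J e \<omega> \<in> half e}" for e
  have half: "half e \<in> sets borel" for e by (simp add: half_def)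
  define q where "q = min (measure ?N {..<0}) (measure ?N {0<..})"
  have q: "q > 0" using normal_half_lines_pos[OF s] by (simp add: q_def)
  have q1: "q \<le> 1"
    using prob_space.prob_le_1[OF prob_space_normal_density[OF s]] by (auto simp: q_def min_le_iff_disj)
  have indA: "indep_events A (edges (strip k))"
    unfolding A_def by (rule indep_eventsI_indep_vars[OF ind]) (use half in auto)
  have pA: "q \<le> prob (A e)" if "e \<in> edges (strip k)" for e
  proof -
    have "A e = J e -` half e \<inter> space M" by (auto simp: A_def)
    then have "prob (A e) = measure (distr M lborel (J e)) (half e)"
      using distributed_measurable[OF J[OF that]] half by (subst measure_distr) auto
    also have "distr M lborel (J e) = ?N" by (rule distributed_distr_eq_density[OF J[OF that]])
    finally show ?thesis by (auto simp: half_def q_def)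
  qed
  define G where "G n = ladder k (2 * z n)" for n
  have G: "finite (G n)" "G n \<noteq> {}" "G n \<subseteq> edges (strip k)" for n
    using ladder_subset[OF k] by (auto simp: G_def ladder_def)
  have "G m \<inter> G n = {}" if "m \<noteq> n" for m n
  proof -
    have "z m \<noteq> z n" using z that by (auto dest: injD)
    moreover have "2 * z m \<noteq> 2 * z n + 1" "2 * z m + 1 \<noteq> 2 * z n" by presburger+
    ultimately show ?thesis by (auto simp: G_def ladder_def)
  qed
  then have disj: "disjoint_family G" by (auto simp: disjoint_family_on_def)
  note blocks = indep_events_blocks[OF indA G disj]
  \<comment> \<open>The exponent only needs to bound the number of edges of a ladder uniformly in \<open>n\<close>.\<close>
  have bound: "q ^ nat (2 + 2 * (2 * k)) \<le> prob (\<Inter>e\<in>G n. A e)" for n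
  proof -
    have "card (G n) \<le> nat (2 + 2 * (2 * k))"
    proof -
      have "card (G n) \<le> card {vedge (- k) (2 * z n), vedge k (2 * z n)}
          + card ((\<lambda>x. hedge x (2 * z n)) ` {- k..<k}) + card ((\<lambda>x. hedge x (2 * z n + 1)) ` {- k..<k})"
        unfolding G_def ladder_def by (meson card_Un_le add_le_mono1 order_trans)
      also have "\<dots> \<le> 2 + nat (2 * k) + nat (2 * k)"
        using k by (intro add_mono card_image_le[THEN order_trans]) (auto simp: card_insert_if)
      finally show ?thesis using k by simp
    qed
    then have "q ^ nat (2 + 2 * (2 * k)) \<le> q ^ card (G n)" using q q1 by (intro power_decreasing) auto
    also have "\<dots> = (\<Prod>e\<in>G n. q)" by simp
    also have "\<dots> \<le> (\<Prod>e\<in>G n. prob (A e))" using q G(3)[of n] pA by (intro prod_mono) auto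
    finally show ?thesis by (simp only: blocks(2))
  qed
  have "AE \<omega> in M. infinite {n. \<omega> \<in> (\<Inter>e\<in>G n. A e)}"
    by (rule AE_infinitely_often[OF blocks(1) zero_less_power[OF q] bound])
  then show ?thesis
  proof eventually_elim
    case (elim \<omega>)
    have "row_sign (\<lambda>e. J e \<omega>) k (2 * z n + 1) = - row_sign (\<lambda>e. J e \<omega>) k (2 * z n)"
      if \<omega>: "\<omega> \<in> (\<Inter>e\<in>G n. A e)" for n
    proof (rule row_sign_flip[OF k])
      have "vedge (- k) (2 * z n) \<in> G n" by (simp add: G_def ladder_def)
      then have "\<omega> \<in> A (vedge (- k) (2 * z n))" by (rule INT_D[OF \<omega>])
      then show "J (vedge (- k) (2 * z n)) \<omega> < 0" by (simp add: A_def half_def)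
      fix e assume e: "e \<in> ladder k (2 * z n)" "e \<noteq> vedge (- k) (2 * z n)"
      then have "\<omega> \<in> A e" by (intro INT_D[OF \<omega>]) (simp add: G_def)
      moreover have "e \<notin> range (vedge (- k))"
      proof -
        have ne: "k \<noteq> - k" using k by linarith
        from e consider "e = vedge k (2 * z n)" | x y where "e = hedge x y"
          unfolding ladder_def by blast
        then show ?thesis by cases (use ne in \<open>simp_all add: image_iff\<close>)
      qed
      ultimately show "0 < J e \<omega>" by (simp add: A_def half_def)
    qed
    then have "{n. \<omega> \<in> (\<Inter>e\<in>G n. A e)}
        \<subseteq> {n. row_sign (\<lambda>e. J e \<omega>) k (2 * z n + 1) = - row_sign (\<lambda>e. J e \<omega>) k (2 * z n)}" by blast
    then show ?case using elim finite_subset by blast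
  qed
qed

text \<open>Of the two rows at a flip one has sign \<open>\<epsilon>\<close>. The predicate \<open>P b\<close>, true for rows far out along
  \<open>z\<close>, stands for lying above or below \<open>b\<close>.\<close>

lemma both_row_signs:
  fixes z :: "nat \<Rightarrow> int"
  assumes inf: "infinite {n. row_sign J k (2 * z n + 1) = - row_sign J k (2 * z n)}"
    and tail: "\<And>b. finite {n. \<not> P b (2 * z n)}" "\<And>b. finite {n. \<not> P b (2 * z n + 1)}"
    and \<epsilon>: "\<epsilon> = 1 \<or> \<epsilon> = - 1"
  shows "\<exists>y. P (b :: int) y \<and> row_sign J k y = \<epsilon>"
proof -
  have "infinite ({n. row_sign J k (2 * z n + 1) = - row_sign J k (2 * z n)}
      - ({n. \<not> P b (2 * z n)} \<union> {n. \<not> P b (2 * z n + 1)}))"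
    using inf tail[of b] by (intro Diff_infinite_finite) auto
  from infinite_imp_nonempty[OF this] obtain n where n: "row_sign J k (2 * z n + 1) = - row_sign J k (2 * z n)"
    "P b (2 * z n)" "P b (2 * z n + 1)" by blast
  then show ?thesis using row_sign_cases[of J k "2 * z n"] \<epsilon> by fastforce
qed

lemma countable_edges: "countable (edges V)"
proof -
  have "edges V \<subseteq> (\<lambda>(u, v). {u, v}) ` UNIV" by (auto simp: edges_def)
  then show ?thesis by (rule countable_subset) auto
qed

theorem mainTheorem3:
  fixes k :: int
    and M :: "'a measure"
    and J :: "edge \<Rightarrow> 'a \<Rightarrow> real"
    and s :: real
  assumes "k \<ge> 1"
    and "prob_space M"
    and "s > 0"
    and "prob_space.indep_vars M (\<lambda>_. borel) J (edges (strip k))"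
    and "\<And>e. e \<in> edges (strip k) \<Longrightarrow> distributed M lborel (J e) (normal_density 0 s)"
  shows "\<exists>A\<in>sets M. measure M A > 0 \<and>
    (\<forall>\<omega>\<in>A. \<exists>S. exhausting_sublattices k S \<and>
       (\<forall>es os.
          (\<forall>j\<ge>1. c_groundstate (\<lambda>e. J e \<omega>) (S (2 * j)) (es j)) \<and>
          (\<forall>j\<ge>1. c_groundstate (\<lambda>e. J e \<omega>) (S (2 * j - 1)) (os j)) \<longrightarrow>
          (\<exists>even_limit odd_limit.
             converges_to k es even_limit \<and> converges_to k os odd_limit \<and>
             finitely_incongruent (\<lambda>e. J e \<omega>) k even_limit odd_limit)))"
proof -
  interpret prob_space M by fact
  let ?J = "\<lambda>\<omega> e. J e \<omega>"
  let ?flip = "\<lambda>\<omega> z. infinite {n. row_sign (?J \<omega>) k (2 * z n + 1) = - row_sign (?J \<omega>) k (2 * z n)}"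
  let ?F = "{G. finite G \<and> G \<subseteq> edges (strip k)}"
  \<comment> \<open>Ties are excluded for each of the countably many pairs of finite edge sets, hence for all at once.\<close>
  have "AE \<omega> in M. \<forall>(G, H) \<in> ?F \<times> ?F. G \<inter> H = {} \<longrightarrow> G \<union> H \<noteq> {} \<longrightarrow> sum (?J \<omega>) G \<noteq> sum (?J \<omega>) H"
  proof (subst AE_ball_countable)
    show "countable (?F \<times> ?F)"
      by (intro countable_SIGMA countable_Collect_finite_subset countable_edges)
    show "\<forall>p\<in>?F \<times> ?F. AE \<omega> in M. case p of (G, H) \<Rightarrow>
        G \<inter> H = {} \<longrightarrow> G \<union> H \<noteq> {} \<longrightarrow> sum (?J \<omega>) G \<noteq> sum (?J \<omega>) H"
    proof (clarify)
      fix G H :: "edge set" assume "finite G" "G \<subseteq> edges (strip k)" "finite H" "H \<subseteq> edges (strip k)"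
      then show "AE \<omega> in M. G \<inter> H = {} \<longrightarrow> G \<union> H \<noteq> {} \<longrightarrow> sum (?J \<omega>) G \<noteq> sum (?J \<omega>) H"
        using AE_sums_distinct[OF assms(3,4,5), of G H] by (cases "G \<inter> H = {} \<and> G \<union> H \<noteq> {}") auto
    qed
  qed
  then have gen: "AE \<omega> in M. generic k (?J \<omega>)"
    by eventually_elim (auto simp: generic_def)
  have up: "AE \<omega> in M. ?flip \<omega> int"
    by (rule AE_flips[OF assms(1,3,4,5)]) (auto simp: inj_def)
  have down: "AE \<omega> in M. ?flip \<omega> (\<lambda>n. - int n)"
    by (rule AE_flips[OF assms(1,3,4,5)]) (auto simp: inj_def)
  from gen up down have "AE \<omega> in M. generic k (?J \<omega>) \<and> ?flip \<omega> int \<and> ?flip \<omega> (\<lambda>n. - int n)"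
    by eventually_elim blast
  then obtain N where N: "{\<omega> \<in> space M. \<not> (generic k (?J \<omega>) \<and> ?flip \<omega> int \<and> ?flip \<omega> (\<lambda>n. - int n))} \<subseteq> N"
    "emeasure M N = 0" "N \<in> sets M"
    by (rule AE_E)
  have bounded: "finite {n. \<not> b < 2 * int n}" "finite {n. \<not> b < 2 * int n + 1}"
    "finite {n. \<not> 2 * - int n < b}" "finite {n. \<not> 2 * - int n + 1 < b}" for b
    by (rule finite_subset[of _ "{..nat \<bar>b\<bar> + 1}"]; auto)+
  show ?thesis
  proof (intro bexI conjI ballI)
    show "space M - N \<in> sets M" using N(3) by auto
    have "prob N = 0" using N(2) by (simp add: measure_def)
    then show "prob (space M - N) > 0" using prob_compl[OF N(3)] by simp
    fix \<omega> assume "\<omega> \<in> space M - N"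
    then have \<omega>: "generic k (?J \<omega>)" "?flip \<omega> int" "?flip \<omega> (\<lambda>n. - int n)" using N(1) by auto
    show "\<exists>S. exhausting_sublattices k S \<and>
       (\<forall>es os.
          (\<forall>j\<ge>1. c_groundstate (?J \<omega>) (S (2 * j)) (es j)) \<and>
          (\<forall>j\<ge>1. c_groundstate (?J \<omega>) (S (2 * j - 1)) (os j)) \<longrightarrow>
          (\<exists>even_limit odd_limit.
             converges_to k es even_limit \<and> converges_to k os odd_limit \<and>
             finitely_incongruent (?J \<omega>) k even_limit odd_limit))"
    proof (rule incongruent_limits[OF assms(1) \<omega>(1)])
      fix \<epsilon> :: real and b assume "\<epsilon> = 1 \<or> \<epsilon> = - 1"
      show "\<exists>y>b. row_sign (?J \<omega>) k y = \<epsilon>"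
        by (rule both_row_signs[OF \<omega>(2), of "(<)"]) fact+
      show "\<exists>y<b. row_sign (?J \<omega>) k y = \<epsilon>"
        by (rule both_row_signs[OF \<omega>(3), of "\<lambda>b y. y < b"]) fact+
    qed
  qed
qed

end
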